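(* Let $n\ge 1$ and let $\iota:U(n+1)\longrightarrow \operatorname{Cont}(\mathbb{S}^{2n+1},\xi_0)$ be the inclusion given by the linear action of $U(n+1)$ on $\mathbb{C}^{n+1}$ restricted to the unit sphere. Then for every positive integer $j\le 2n+1$ the induced homomorphism $$\pi_j(\iota):\pi_j(U(n+1))\longrightarrow\pi_j(\operatorname{Cont}(\mathbb{S}^{2n+1},\xi_0))$$ is injective.
   Context: $\mathbb{S}^{2n+1}=\{z\in\mathbb{C}^{n+1}:|z|^2=1\}$ and $\xi_0=T\mathbb{S}^{2n+1}\cap i(T\mathbb{S}^{2n+1})$ is the standard contact structure given by the complex tangencies. A unitary map $A$ satisfies $A_*(\xi_0(z))=\xi_0(Az)$, so $U(n+1)$ acts on $(\mathbb{S}^{2n+1},\xi_0)$ by contactomorphisms. $\operatorname{Cont}(\mathbb{S}^{2n+1},\xi_0)$ is the group of contactomorphisms (diffeomorphisms preserving $\xi_0$) with the $C^\infty$-topology; homotopy groups are based at the identity. *)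

theory Defs
  imports "HOL-Analysis.Analysis" "HOL-Algebra.Group"
begin

section \<open>Homotopy groups\<close>

text \<open>
  The cube is \<open>[0,1]\<^sup>j\<close> with coordinates indexed by \<open>{..<j}\<close>; its points are extensional functions.
\<close>

definition cube :: "nat \<Rightarrow> (nat \<Rightarrow> real) topology" where
  "cube j = product_topology (\<lambda>_. top_of_set {0..1}) {..<j}"

definition cube_boundary :: "nat \<Rightarrow> (nat \<Rightarrow> real) set" where
  "cube_boundary j = {t \<in> topspace (cube j). \<exists>i<j. t i = 0 \<or> t i = 1}"

definition spheroids :: "nat \<Rightarrow> 'x topology \<Rightarrow> 'x \<Rightarrow> ((nat \<Rightarrow> real) \<Rightarrow> 'x) set" where
  "spheroids j X x0 = {f. continuous_map (cube j) X f \<and> (\<forall>t\<in>cube_boundary j. f t = x0)}"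

definition spheroid_homotopic ::
    "nat \<Rightarrow> 'x topology \<Rightarrow> 'x \<Rightarrow> ((nat \<Rightarrow> real) \<Rightarrow> 'x) \<Rightarrow> ((nat \<Rightarrow> real) \<Rightarrow> 'x) \<Rightarrow> bool" where
  "spheroid_homotopic j X x0 = homotopic_with (\<lambda>f. \<forall>t\<in>cube_boundary j. f t = x0) (cube j) X"

definition spheroid_class ::
    "nat \<Rightarrow> 'x topology \<Rightarrow> 'x \<Rightarrow> ((nat \<Rightarrow> real) \<Rightarrow> 'x) \<Rightarrow> ((nat \<Rightarrow> real) \<Rightarrow> 'x) set" where
  "spheroid_class j X x0 f = {g. spheroid_homotopic j X x0 f g}"

definition spheroid_concat ::
    "((nat \<Rightarrow> real) \<Rightarrow> 'x) \<Rightarrow> ((nat \<Rightarrow> real) \<Rightarrow> 'x) \<Rightarrow> (nat \<Rightarrow> real) \<Rightarrow> 'x" where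
  "spheroid_concat f g t =
     (if t 0 \<le> 1/2 then f (t(0 := 2 * t 0)) else g (t(0 := 2 * t 0 - 1)))"

text \<open>
  \<open>homotopy_group j X x0\<close> is \<open>\<pi>\<^sub>j(X, x0)\<close>; it is meant for \<open>j \<ge> 1\<close> and \<open>x0 \<in> topspace X\<close>.
  Multiplication and induced maps are given on classes as the union of all the results obtained
  from representatives, which is a single class because the operations respect homotopy.
\<close>

definition homotopy_group ::
    "nat \<Rightarrow> 'x topology \<Rightarrow> 'x \<Rightarrow> ((nat \<Rightarrow> real) \<Rightarrow> 'x) set monoid" where
  "homotopy_group j X x0 =
     \<lparr>carrier = spheroid_class j X x0 ` spheroids j X x0,
      mult = (\<lambda>a b. \<Union>f\<in>a. \<Union>g\<in>b. spheroid_class j X x0 (spheroid_concat f g)),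
      one = spheroid_class j X x0 (\<lambda>_. x0)\<rparr>"

definition homotopy_group_map ::
    "nat \<Rightarrow> 'y topology \<Rightarrow> 'y \<Rightarrow> ('x \<Rightarrow> 'y) \<Rightarrow>
     ((nat \<Rightarrow> real) \<Rightarrow> 'x) set \<Rightarrow> ((nat \<Rightarrow> real) \<Rightarrow> 'y) set" where
  "homotopy_group_map j Y y0 \<phi> a = (\<Union>f\<in>a. spheroid_class j Y y0 (\<phi> \<circ> f))"


section \<open>Smooth maps on subsets of Euclidean space\<close>

text \<open>
  \<open>iter_deriv [v\<^sub>1, \<dots>, v\<^sub>k] f x\<close> is the iterated directional derivative
  \<open>D\<^sup>k f(x)[v\<^sub>1, \<dots>, v\<^sub>k]\<close>. In finite dimensions, differentiability of all of these on an open set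
  is the same as being of class \<open>C\<^sup>\<infinity>\<close> there.
\<close>

primrec iter_deriv ::
    "'a::euclidean_space list \<Rightarrow> ('a \<Rightarrow> 'b::euclidean_space) \<Rightarrow> 'a \<Rightarrow> 'b" where
  "iter_deriv [] f = f"
| "iter_deriv (v # vs) f = (\<lambda>x. frechet_derivative (iter_deriv vs f) (at x) v)"

definition smooth_on :: "'a::euclidean_space set \<Rightarrow> ('a \<Rightarrow> 'b::euclidean_space) \<Rightarrow> bool" where
  "smooth_on U f \<longleftrightarrow> open U \<and> (\<forall>vs. \<forall>x\<in>U. iter_deriv vs f differentiable (at x))"

text \<open>On an arbitrary subset, smooth means locally extendable to a smooth map.\<close>

definition smooth_map_on :: "'a::euclidean_space set \<Rightarrow> ('a \<Rightarrow> 'b::euclidean_space) \<Rightarrow> bool" where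
  "smooth_map_on S f \<longleftrightarrow>
     (\<forall>z\<in>S. \<exists>W g. z \<in> W \<and> smooth_on W g \<and> (\<forall>x\<in>S \<inter> W. g x = f x))"

definition diffeomorphism_on :: "'a::euclidean_space set \<Rightarrow> ('a \<Rightarrow> 'a) \<Rightarrow> bool" where
  "diffeomorphism_on S f \<longleftrightarrow>
     bij_betw f S S \<and> smooth_map_on S f \<and> smooth_map_on S (inv_into S f)"

definition tangent_space :: "'a::euclidean_space set \<Rightarrow> 'a \<Rightarrow> 'a set" where
  "tangent_space S z =
     {v. \<exists>\<gamma>::real \<Rightarrow> 'a. smooth_on UNIV \<gamma> \<and> range \<gamma> \<subseteq> S \<and> \<gamma> 0 = z
           \<and> (\<gamma> has_vector_derivative v) (at 0)}"

text \<open>Inverses of charts of \<open>S\<close>: diffeomorphisms from an open \<open>U\<close> onto a relatively open part of \<open>S\<close>.\<close>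

definition local_parametrization ::
    "'a::euclidean_space set \<Rightarrow> 'm::euclidean_space set \<Rightarrow> ('m \<Rightarrow> 'a) \<Rightarrow> bool" where
  "local_parametrization S U u \<longleftrightarrow>
     smooth_on U u \<and> inj_on u U \<and> openin (top_of_set S) (u ` U)
     \<and> smooth_map_on (u ` U) (inv_into U u)"


section \<open>The standard contact sphere\<close>

text \<open>
  With \<open>n = CARD('n) \<ge> 1\<close>, the type \<open>'n option\<close> has \<open>n + 1\<close> elements and \<open>'n + 'n option\<close> has
  \<open>2 n + 1\<close>; so \<open>'n cvec\<close> is complex \<open>(n+1)\<close>-space and \<open>'n chart_space\<close> is real \<open>(2n+1)\<close>-space.
\<close>

type_synonym 'n cvec = "complex ^ ('n option)"
type_synonym 'n chart_space = "real ^ ('n + 'n option)"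

abbreviation unit_sphere :: "('n::finite) cvec set" where
  "unit_sphere \<equiv> sphere 0 1"

definition contact_structure :: "('n::finite) cvec \<Rightarrow> 'n cvec set" where
  "contact_structure z =
     tangent_space unit_sphere z \<inter> (\<lambda>v. \<i> *s v) ` tangent_space unit_sphere z"

text \<open>
  A derivative of \<open>f\<close> at \<open>z\<close> within the sphere is determined only on vectors tangent to the sphere,
  where it is the differential of \<open>f\<close>. Maps of the sphere are taken extensional, so that equality of
  functions is equality on the sphere.
\<close>

definition contactomorphisms :: "(('n::finite) cvec \<Rightarrow> 'n cvec) set" where
  "contactomorphisms =
     {f \<in> extensional unit_sphere.
        diffeomorphism_on unit_sphere f \<and>
        (\<forall>z\<in>unit_sphere. \<exists>D. (f has_derivative D) (at z within unit_sphere) \<and>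
           D ` contact_structure z = contact_structure (f z))}"

text \<open>
  The \<open>C\<^sup>\<infinity>\<close>-topology on smooth maps from the sphere to the ambient vector space: uniform convergence
  of all partial derivatives in local charts, on compact subsets of the chart domains.
\<close>

definition C_infinity_topology :: "(('n::finite) cvec \<Rightarrow> 'n cvec) topology" where
  "C_infinity_topology = topology_generated_by
     {{g \<in> extensional unit_sphere. smooth_map_on unit_sphere g \<and>
         (\<forall>x\<in>K. norm (iter_deriv vs (g \<circ> u) x - iter_deriv vs (f \<circ> u) x) < \<epsilon>)}
      | (U :: 'n chart_space set) u K vs f \<epsilon>.
         local_parametrization unit_sphere U u \<and> compact K \<and> K \<subseteq> U \<and>
         f \<in> extensional unit_sphere \<and> smooth_map_on unit_sphere f \<and> 0 < \<epsilon>}"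

definition Cont_topology :: "(('n::finite) cvec \<Rightarrow> 'n cvec) topology" where
  "Cont_topology = subtopology C_infinity_topology contactomorphisms"


section \<open>The unitary group and its action\<close>

definition conj_transpose :: "complex ^ 'm ^ 'k \<Rightarrow> complex ^ 'k ^ 'm" where
  "conj_transpose A = (\<chi> i j. cnj (A $ j $ i))"

definition unitary_group :: "(complex ^ 'm ^ 'm) set" where
  "unitary_group = {A. conj_transpose A ** A = mat 1 \<and> A ** conj_transpose A = mat 1}"

definition unitary_action ::
    "complex ^ ('n option) ^ ('n option) \<Rightarrow> ('n::finite) cvec \<Rightarrow> 'n cvec" where
  "unitary_action A = restrict (\<lambda>z. A *v z) unit_sphere"

end

theory Submission
  imports Defs
begin

text \<open>
  The differential of a contactomorphism \<open>f\<close> at the base point \<open>e\<close> gives a homotopy left inverse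
  of \<open>\<iota>\<close>. On the contact hyperplane at \<open>e\<close> the differential \<open>L\<close> of \<open>f\<close> is symplectic up to a nonzero
  factor, as one sees by differentiating the relation between the contact form and its pullback.
  Along a path starting at a unitary map this factor stays positive, which makes the complex linear
  part of \<open>L\<close> injective there. So \<open>f e\<close> together with the complex linear part of \<open>L\<close> is an
  invertible complex matrix depending continuously on \<open>f\<close>, which is \<open>A\<close> itself if \<open>f\<close> is the action
  of a unitary \<open>A\<close>. Composing with Gram--Schmidt gives the left inverse.
\<close>

section \<open>Calculus of iterated directional derivatives\<close>

text \<open>Positivity of the factor is a real restriction: complex conjugation is a
  contactomorphism with factor -1, and there the complex linear part of \<open>L\<close> vanishes on
  the contact hyperplane. So the matrix does not retract the whole contactomorphism group onto
  unitary maps. A homotopy of spheroids, however, is swept out by paths starting at unitary maps,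
  and injectivity asks for no more. The factor cannot change sign along a path because it never
  vanishes: \<open>L\<close> maps the contact hyperplane onto another complex hyperplane, where
  every \<open>p \<noteq> 0\<close> pairs positively with \<open>\<i> p\<close>. If the complex
  linear part killed \<open>z\<close>, then \<open>L\<close> would be antilinear on the complex line
  of \<open>z\<close>, and the symplectic form would be nonpositive on \<open>L z\<close> and
  \<open>L (\<i> z)\<close>, against positivity. Only a first derivative in one chart at one point
  is used, and such evaluations are continuous in the smooth topology.\<close>

lemma iter_deriv_append: "iter_deriv (vs @ ws) f = iter_deriv vs (iter_deriv ws f)"
  by (induction vs) auto

lemma iter_deriv_cong:
  assumes "open U" "\<And>x. x \<in> U \<Longrightarrow> f x = g x" "x \<in> U"
  shows "iter_deriv vs f x = iter_deriv vs g x"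
  using assms(3)
proof (induction vs arbitrary: x)
  case (Cons v vs)
  show ?case
  proof (cases "iter_deriv vs f differentiable at x")
    case True
    then show ?thesis
      using frechet_derivative_transform_within_open[OF True assms(1) Cons.prems, of "iter_deriv vs g"] Cons.IH
      by auto
  next
    case False
    \<comment> \<open>\<open>frechet_derivative\<close> is a choice, so the two functions must be
      shown to have the same set of derivatives even where that set is empty.\<close>
    have "(iter_deriv vs f has_derivative D) (at x) \<longleftrightarrow> (iter_deriv vs g has_derivative D) (at x)" for D
      using has_derivative_transform_within_open[OF _ assms(1) Cons.prems] Cons.IH by metis
    then show ?thesis by (simp add: frechet_derivative_def)
  qed
qed (use assms in auto)

text \<open>A finite order \<open>k\<close> lets the closure properties of smooth maps be proved by induction on \<open>k\<close>.\<close>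

definition ksmooth_on :: "nat \<Rightarrow> 'a::euclidean_space set \<Rightarrow> ('a \<Rightarrow> 'b::euclidean_space) \<Rightarrow> bool" where
  "ksmooth_on k U f \<longleftrightarrow> open U \<and> (\<forall>vs. length vs < k \<longrightarrow> (\<forall>x\<in>U. iter_deriv vs f differentiable (at x)))"

lemma smooth_on_iff_ksmooth: "smooth_on U f \<longleftrightarrow> (\<forall>k. ksmooth_on k U f)"
  unfolding smooth_on_def ksmooth_on_def by blast

lemma ksmooth_on_0: "ksmooth_on 0 U f \<longleftrightarrow> open U"
  by (simp add: ksmooth_on_def)

lemma ksmooth_on_Suc:
  "ksmooth_on (Suc k) U f \<longleftrightarrow> open U \<and> (\<forall>x\<in>U. f differentiable (at x)) \<and>
     (\<forall>v. ksmooth_on k U (\<lambda>x. frechet_derivative f (at x) v))"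
proof (intro iffI conjI ballI allI)
  fix x v assume f: "ksmooth_on (Suc k) U f"
  show "open U" using f by (simp add: ksmooth_on_def)
  show "f differentiable (at x)" if "x \<in> U"
    using f that unfolding ksmooth_on_def by (metis iter_deriv.simps(1) list.size(3) zero_less_Suc)
  have "length (vs @ [v]) < Suc k \<longrightarrow> (\<forall>x\<in>U. iter_deriv (vs @ [v]) f differentiable (at x))" for vs
    using f unfolding ksmooth_on_def by blast
  then show "ksmooth_on k U (\<lambda>x. frechet_derivative f (at x) v)"
    using f unfolding ksmooth_on_def iter_deriv_append by simp
next
  assume *: "open U \<and> (\<forall>x\<in>U. f differentiable (at x)) \<and>
     (\<forall>v. ksmooth_on k U (\<lambda>x. frechet_derivative f (at x) v))"
  show "ksmooth_on (Suc k) U f"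
    unfolding ksmooth_on_def
  proof (intro conjI allI impI ballI)
    fix vs :: "'a list" and x assume "length vs < Suc k" "x \<in> U"
    \<comment> \<open>The last entry of the list is the first differentiation, so the list is split
      at its end.\<close>
    then show "iter_deriv vs f differentiable at x"
      using * by (cases vs rule: rev_cases) (auto simp: iter_deriv_append ksmooth_on_def)
  qed (use * in auto)
qed

lemma ksmooth_on_SucD: "ksmooth_on (Suc k) U f \<Longrightarrow> ksmooth_on k U f"
  by (simp add: ksmooth_on_def)

lemma ksmooth_on_open: "ksmooth_on k U f \<Longrightarrow> open U"
  by (simp add: ksmooth_on_def)

lemma ksmooth_on_cong:
  assumes "\<And>x. x \<in> U \<Longrightarrow> f x = g x" "ksmooth_on k U f"
  shows "ksmooth_on k U g"
  unfolding ksmooth_on_def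
proof (intro conjI allI impI ballI)
  show "open U" using assms(2) by (rule ksmooth_on_open)
  fix vs :: "'a list" and x assume "length vs < k" "x \<in> U"
  then have "iter_deriv vs f differentiable at x" using assms(2) by (simp add: ksmooth_on_def)
  then obtain D where "(iter_deriv vs f has_derivative D) (at x)" by (auto simp: differentiable_def)
  then have "(iter_deriv vs g has_derivative D) (at x)"
    by (rule has_derivative_transform_within_open[OF _ \<open>open U\<close> \<open>x \<in> U\<close>])
       (rule iter_deriv_cong[OF \<open>open U\<close> assms(1)])
  then show "iter_deriv vs g differentiable at x" by (auto simp: differentiable_def)
qed

text \<open>An explicit derivative may stand in for the one chosen by
  \<open>frechet_derivative\<close>, so the inductions below can use the usual derivative
  formulas.\<close>

lemma ksmooth_on_SucI:
  assumes "open U" "\<And>x. x \<in> U \<Longrightarrow> (f has_derivative f' x) (at x)"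
    "\<And>v. ksmooth_on k U (\<lambda>x. f' x v)"
  shows "ksmooth_on (Suc k) U f"
  unfolding ksmooth_on_Suc
proof (intro conjI ballI allI)
  show "f differentiable at x" if "x \<in> U" for x
    using assms(2)[OF that] by (auto simp: differentiable_def)
  show "ksmooth_on k U (\<lambda>x. frechet_derivative f (at x) v)" for v
    by (rule ksmooth_on_cong[OF _ assms(3)]) (simp add: frechet_derivative_at[OF assms(2), symmetric])
qed fact

lemma ksmooth_on_SucE:
  assumes "ksmooth_on (Suc k) U f"
  obtains f' where "\<And>x. x \<in> U \<Longrightarrow> (f has_derivative f' x) (at x)" "\<And>v. ksmooth_on k U (\<lambda>x. f' x v)"
  using that[of "\<lambda>x. frechet_derivative f (at x)"] assms
  by (simp add: ksmooth_on_Suc frechet_derivative_works)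

lemma ksmooth_on_const: "open U \<Longrightarrow> ksmooth_on k U (\<lambda>x. c)"
proof (induction k arbitrary: c)
  case (Suc k)
  show ?case by (rule ksmooth_on_SucI[where f'="\<lambda>_ _. 0"]) (use Suc in auto)
qed (auto simp: ksmooth_on_0)

lemma ksmooth_on_linear:
  assumes "bounded_linear f" "open U" shows "ksmooth_on k U f"
proof (cases k)
  case (Suc k')
  show ?thesis unfolding Suc
    by (rule ksmooth_on_SucI[where f'="\<lambda>_. f"])
       (use assms in \<open>auto intro: bounded_linear_imp_has_derivative ksmooth_on_const\<close>)
qed (simp add: ksmooth_on_0 assms)

lemma ksmooth_on_add:
  "ksmooth_on k U f \<Longrightarrow> ksmooth_on k U g \<Longrightarrow> ksmooth_on k U (\<lambda>x. f x + g x)"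
proof (induction k arbitrary: f g)
  case (Suc k)
  obtain f' where f': "\<And>x. x \<in> U \<Longrightarrow> (f has_derivative f' x) (at x)" "\<And>v. ksmooth_on k U (\<lambda>x. f' x v)"
    using ksmooth_on_SucE[OF Suc.prems(1)] by blast
  obtain g' where g': "\<And>x. x \<in> U \<Longrightarrow> (g has_derivative g' x) (at x)" "\<And>v. ksmooth_on k U (\<lambda>x. g' x v)"
    using ksmooth_on_SucE[OF Suc.prems(2)] by blast
  show ?case
    by (rule ksmooth_on_SucI[where f'="\<lambda>x v. f' x v + g' x v"])
       (use f' g' Suc.IH ksmooth_on_open[OF Suc.prems(1)] in \<open>auto intro: has_derivative_add\<close>)
qed (simp add: ksmooth_on_0)

lemma ksmooth_on_sum:
  assumes "open U" "\<And>i. i \<in> I \<Longrightarrow> ksmooth_on k U (f i)"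
  shows "ksmooth_on k U (\<lambda>x. \<Sum>i\<in>I. f i x)"
  using assms(2)
proof (induction I rule: infinite_finite_induct)
  case (insert i I)
  then show ?case using ksmooth_on_add[of k U "f i" "\<lambda>x. \<Sum>i\<in>I. f i x"] by simp
qed (simp_all add: ksmooth_on_const assms(1))

lemma ksmooth_on_scaleR:
  fixes f :: "'a::euclidean_space \<Rightarrow> real"
  shows "ksmooth_on k U f \<Longrightarrow> ksmooth_on k U g \<Longrightarrow> ksmooth_on k U (\<lambda>x. f x *\<^sub>R g x)"
proof (induction k arbitrary: f g)
  case (Suc k)
  obtain f' where f': "\<And>x. x \<in> U \<Longrightarrow> (f has_derivative f' x) (at x)" "\<And>v. ksmooth_on k U (\<lambda>x. f' x v)"
    using ksmooth_on_SucE[OF Suc.prems(1)] by blast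
  obtain g' where g': "\<And>x. x \<in> U \<Longrightarrow> (g has_derivative g' x) (at x)" "\<And>v. ksmooth_on k U (\<lambda>x. g' x v)"
    using ksmooth_on_SucE[OF Suc.prems(2)] by blast
  show ?case
  proof (rule ksmooth_on_SucI[where f'="\<lambda>x v. f x *\<^sub>R g' x v + f' x v *\<^sub>R g x"])
    show "ksmooth_on k U (\<lambda>x. f x *\<^sub>R g' x v + f' x v *\<^sub>R g x)" for v
      using Suc.IH f'(2) g'(2) ksmooth_on_SucD[OF Suc.prems(1)] ksmooth_on_SucD[OF Suc.prems(2)]
      by (auto intro!: ksmooth_on_add)
  qed (use f' g' ksmooth_on_open[OF Suc.prems(1)] in \<open>auto intro: has_derivative_scaleR\<close>)
qed (simp add: ksmooth_on_0)

text \<open>Differentiation lowers the exponent to \<open>a - 1\<close>, hence the induction over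
  all exponents. The case \<open>1/2\<close> gives the square root in the hemisphere chart.\<close>

lemma ksmooth_on_powr:
  fixes h :: "'a::euclidean_space \<Rightarrow> real"
  assumes "\<And>k. ksmooth_on k U h" "\<And>x. x \<in> U \<Longrightarrow> h x > 0"
  shows "ksmooth_on k U (\<lambda>x. h x powr a)"
proof (induction k arbitrary: a)
  case (Suc k)
  obtain h' where h': "\<And>x. x \<in> U \<Longrightarrow> (h has_derivative h' x) (at x)" "\<And>v. ksmooth_on k U (\<lambda>x. h' x v)"
    using ksmooth_on_SucE[OF assms(1)] by blast
  show ?case
  proof (rule ksmooth_on_SucI[where f'="\<lambda>x v. (a *\<^sub>R h x powr (a - 1)) *\<^sub>R h' x v"])
    show "((\<lambda>x. h x powr a) has_derivative (\<lambda>v. (a *\<^sub>R h x powr (a - 1)) *\<^sub>R h' x v)) (at x)" if "x \<in> U" for x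
    proof -
      have "((\<lambda>y. y powr a) has_derivative (\<lambda>v. (a * h x powr (a - 1)) * v)) (at (h x))"
        using has_real_derivative_powr[OF assms(2)[OF that], of a] by (simp add: has_field_derivative_def)
      from has_derivative_compose[OF h'(1)[OF that] this] show ?thesis by simp
    qed
    show "ksmooth_on k U (\<lambda>x. (a *\<^sub>R h x powr (a - 1)) *\<^sub>R h' x v)" for v
      by (intro ksmooth_on_scaleR ksmooth_on_const Suc.IH h'(2)) (rule ksmooth_on_open[OF assms(1)])
  qed (rule ksmooth_on_open[OF assms(1)])
qed (use assms(1) ksmooth_on_0 in blast)

lemma ksmooth_on_compose_linear:
  assumes "bounded_linear l" "ksmooth_on k U f" shows "ksmooth_on k U (\<lambda>x. l (f x))"
  using assms(2)
proof (induction k arbitrary: f)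
  case (Suc k)
  obtain f' where f': "\<And>x. x \<in> U \<Longrightarrow> (f has_derivative f' x) (at x)" "\<And>v. ksmooth_on k U (\<lambda>x. f' x v)"
    using ksmooth_on_SucE[OF Suc.prems(1)] by blast
  show ?case
    by (rule ksmooth_on_SucI[where f'="\<lambda>x v. l (f' x v)"])
       (use f' Suc.IH ksmooth_on_open[OF Suc.prems] in \<open>auto intro: bounded_linear.has_derivative[OF assms(1)]\<close>)
qed (simp add: ksmooth_on_0)

lemma ksmooth_on_compose:
  assumes "ksmooth_on k W g" "ksmooth_on k U f" "f ` U \<subseteq> W"
  shows "ksmooth_on k U (\<lambda>x. g (f x))"
  using assms
proof (induction k arbitrary: g)
  case (Suc k)
  obtain g' where g': "\<And>x. x \<in> W \<Longrightarrow> (g has_derivative g' x) (at x)" "\<And>v. ksmooth_on k W (\<lambda>x. g' x v)"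
    using ksmooth_on_SucE[OF Suc.prems(1)] by blast
  obtain f' where f': "\<And>x. x \<in> U \<Longrightarrow> (f has_derivative f' x) (at x)" "\<And>v. ksmooth_on k U (\<lambda>x. f' x v)"
    using ksmooth_on_SucE[OF Suc.prems(2)] by blast
  have U: "open U" by (rule ksmooth_on_open[OF Suc.prems(2)])
  show ?case
  proof (rule ksmooth_on_SucI[where f'="\<lambda>x v. g' (f x) (f' x v)"])
    show "((\<lambda>x. g (f x)) has_derivative (\<lambda>v. g' (f x) (f' x v))) (at x)" if "x \<in> U" for x
      by (rule has_derivative_compose[OF f'(1)[OF that] g'(1)]) (use that Suc.prems(3) in auto)
    show "ksmooth_on k U (\<lambda>x. g' (f x) (f' x v))" for v
    proof (rule ksmooth_on_cong)
      \<comment> \<open>In the chain rule the direction \<open>f' x v\<close> moves with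
        \<open>x\<close>. Expanding it in the basis leaves products of functions with fixed
        directions, to which the induction hypothesis applies.\<close>
      show "ksmooth_on k U (\<lambda>x. \<Sum>b\<in>Basis. (f' x v \<bullet> b) *\<^sub>R g' (f x) b)"
        by (intro ksmooth_on_sum ksmooth_on_scaleR U Suc.IH g'(2) ksmooth_on_SucD[OF Suc.prems(2)]
            Suc.prems(3) f'(2) ksmooth_on_compose_linear[OF bounded_linear_inner_left])
      fix x assume "x \<in> U"
      then have "linear (g' (f x))"
        using g'(1) Suc.prems(3) has_derivative_linear by blast
      then have "g' (f x) (\<Sum>b\<in>Basis. (f' x v \<bullet> b) *\<^sub>R b) = (\<Sum>b\<in>Basis. (f' x v \<bullet> b) *\<^sub>R g' (f x) b)"
        by (simp add: linear_sum linear_cmul)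
      then show "(\<Sum>b\<in>Basis. (f' x v \<bullet> b) *\<^sub>R g' (f x) b) = g' (f x) (f' x v)"
        by (simp add: euclidean_representation)
    qed
  qed (rule U)
qed (simp add: ksmooth_on_0)

section \<open>Smooth maps: composition, restriction and locality\<close>

lemma smooth_on_openD: "smooth_on U f \<Longrightarrow> open U"
  by (simp add: smooth_on_def)

lemma smooth_on_compose:
  "smooth_on W g \<Longrightarrow> smooth_on U f \<Longrightarrow> f ` U \<subseteq> W \<Longrightarrow> smooth_on U (g \<circ> f)"
  unfolding smooth_on_iff_ksmooth comp_def by (blast intro: ksmooth_on_compose)

lemma smooth_on_linear: "bounded_linear f \<Longrightarrow> open U \<Longrightarrow> smooth_on U f"
  unfolding smooth_on_iff_ksmooth by (blast intro: ksmooth_on_linear)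

lemma smooth_on_subset: "smooth_on U f \<Longrightarrow> open V \<Longrightarrow> V \<subseteq> U \<Longrightarrow> smooth_on V f"
  unfolding smooth_on_def by blast

lemma smooth_on_cong: "smooth_on U f \<Longrightarrow> (\<And>x. x \<in> U \<Longrightarrow> f x = g x) \<Longrightarrow> smooth_on U g"
  unfolding smooth_on_iff_ksmooth by (blast intro: ksmooth_on_cong)

lemma smooth_on_iter_deriv: "smooth_on U f \<Longrightarrow> smooth_on U (iter_deriv vs f)"
  unfolding smooth_on_def by (metis iter_deriv_append)

lemma smooth_on_has_derivative:
  assumes "smooth_on U f" "x \<in> U"
  shows "(f has_derivative (\<lambda>v. iter_deriv [v] f x)) (at x)"
proof -
  have "iter_deriv [] f differentiable at x" using assms unfolding smooth_on_def by blast
  then have "(f has_derivative frechet_derivative f (at x)) (at x)"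
    by (simp add: frechet_derivative_works)
  then show ?thesis by simp
qed

lemma smooth_on_imp_continuous_on: "smooth_on U f \<Longrightarrow> continuous_on U f"
  by (meson continuous_at_imp_continuous_on has_derivative_continuous smooth_on_has_derivative)

lemma smooth_on_locally:
  assumes "open U" "\<And>x. x \<in> U \<Longrightarrow> \<exists>V. x \<in> V \<and> smooth_on V f"
  shows "smooth_on U f"
  using assms unfolding smooth_on_def by blast

text \<open>Each local extension of \<open>f\<close> is seen only on \<open>S\<close>, where it
  agrees with \<open>f\<close>; so the composites with \<open>u\<close> are local pieces of one
  map.\<close>

lemma smooth_map_on_compose_smooth_on:
  assumes f: "smooth_map_on S f" and u: "smooth_on U u" "u ` U \<subseteq> S"
  shows "smooth_on U (f \<circ> u)"
proof (rule smooth_on_locally)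
  show U: "open U" using u by (rule_tac smooth_on_openD)
  fix x assume x: "x \<in> U"
  then obtain W g where W: "u x \<in> W" "smooth_on W g" "\<forall>y\<in>S \<inter> W. g y = f y"
    using f u(2) unfolding smooth_map_on_def by blast
  define V where "V = U \<inter> u -` W"
  have V: "open V" unfolding V_def
    using smooth_on_imp_continuous_on[OF u(1)] smooth_on_openD[OF W(2)] U continuous_open_preimage by blast
  have "smooth_on V (g \<circ> u)"
    by (rule smooth_on_compose[OF W(2)]) (use smooth_on_subset[OF u(1) V] V_def in auto)
  then have "smooth_on V (f \<circ> u)"
  proof (rule smooth_on_cong)
    fix y assume "y \<in> V"
    then have "u y \<in> S \<inter> W" using u(2) by (auto simp: V_def)
    then show "(g \<circ> u) y = (f \<circ> u) y" using W(3) by simp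
  qed
  moreover have "x \<in> V" using x W(1) by (simp add: V_def)
  ultimately show "\<exists>V. x \<in> V \<and> smooth_on V (f \<circ> u)" by blast
qed

lemma iter_deriv_compose_linear:
  assumes "bounded_linear l" "smooth_on U f" "x \<in> U"
  shows "iter_deriv vs (\<lambda>x. l (f x)) x = l (iter_deriv vs f x)"
  using assms(3)
proof (induction vs arbitrary: x)
  case (Cons v vs)
  have "(iter_deriv vs f has_derivative (\<lambda>v. iter_deriv [v] (iter_deriv vs f) x)) (at x)"
    using smooth_on_has_derivative[OF smooth_on_iter_deriv[OF assms(2)] Cons.prems] .
  from bounded_linear.has_derivative[OF assms(1) this]
  have "(iter_deriv vs (\<lambda>x. l (f x)) has_derivative (\<lambda>v. l (iter_deriv [v] (iter_deriv vs f) x))) (at x)"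
    by (rule has_derivative_transform_within_open[OF _ smooth_on_openD[OF assms(2)] Cons.prems])
       (simp add: Cons.IH)
  from frechet_derivative_at[OF this, symmetric] show ?case by simp
qed simp

text \<open>The second difference is symmetric in \<open>v\<close> and \<open>w\<close>; letting \<open>h\<close> tend to 0 gives the symmetry
  of second derivatives.\<close>

lemma second_difference_mean_value:
  fixes f :: "'a::euclidean_space \<Rightarrow> real"
  assumes f: "smooth_on U f" and h: "h > 0"
    and U: "\<And>s t. 0 \<le> s \<Longrightarrow> s \<le> h \<Longrightarrow> 0 \<le> t \<Longrightarrow> t \<le> h \<Longrightarrow> x + s *\<^sub>R v + t *\<^sub>R w \<in> U"
  obtains s t where "0 < s" "s < h" "0 < t" "t < h"
    "f (x + h *\<^sub>R v + h *\<^sub>R w) - f (x + h *\<^sub>R v) - f (x + h *\<^sub>R w) + f x =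
      h\<^sup>2 * iter_deriv [w, v] f (x + s *\<^sub>R v + t *\<^sub>R w)"
proof -
  have D: "((\<lambda>s. g (y + s *\<^sub>R v)) has_real_derivative iter_deriv [v] g (y + s *\<^sub>R v)) (at s)"
    if "smooth_on U g" "y + s *\<^sub>R v \<in> U" for g :: "'a \<Rightarrow> real" and y s v
  proof -
    have "(g has_derivative (\<lambda>z. iter_deriv [z] g (y + s *\<^sub>R v))) (at (y + s *\<^sub>R v))"
      by (rule smooth_on_has_derivative[OF that])
    moreover have "((\<lambda>s. y + s *\<^sub>R v) has_derivative (\<lambda>r. r *\<^sub>R v)) (at s)"
      by (auto intro!: derivative_eq_intros)
    ultimately have d: "((\<lambda>s. g (y + s *\<^sub>R v)) has_derivative (\<lambda>r. iter_deriv [r *\<^sub>R v] g (y + s *\<^sub>R v))) (at s)"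
      using has_derivative_compose by blast
    have "linear (\<lambda>z. iter_deriv [z] g (y + s *\<^sub>R v))"
      using has_derivative_linear smooth_on_has_derivative[OF that] by blast
    then have "iter_deriv [r *\<^sub>R v] g (y + s *\<^sub>R v) = r * iter_deriv [v] g (y + s *\<^sub>R v)" for r
      using linear_cmul by fastforce
    with d show ?thesis by (simp add: has_field_derivative_def mult_commute_abs)
  qed
  \<comment> \<open>The second difference is the increment of \<open>p\<close> over the interval
    from 0 to \<open>h\<close>. The mean value theorem along \<open>v\<close> and then along
    \<open>w\<close> turns it into a mixed derivative.\<close>
  define p where "p = (\<lambda>s. f ((x + h *\<^sub>R w) + s *\<^sub>R v) - f (x + s *\<^sub>R v))"
  have "\<exists>s. 0 < s \<and> s < h \<and> p h - p 0 =
      (h - 0) * (iter_deriv [v] f ((x + h *\<^sub>R w) + s *\<^sub>R v) - iter_deriv [v] f (x + s *\<^sub>R v))"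
    unfolding p_def
  proof (rule MVT2[OF h])
    fix s assume "0 \<le> s" "s \<le> h"
    then have "x + h *\<^sub>R w + s *\<^sub>R v \<in> U" "x + s *\<^sub>R v \<in> U"
      using U[of s h] U[of s 0] h by (auto simp: algebra_simps)
    then show "((\<lambda>s. f ((x + h *\<^sub>R w) + s *\<^sub>R v) - f (x + s *\<^sub>R v)) has_real_derivative
      (iter_deriv [v] f ((x + h *\<^sub>R w) + s *\<^sub>R v) - iter_deriv [v] f (x + s *\<^sub>R v))) (at s)"
      by (intro DERIV_diff D f)
  qed
  then obtain s where s: "0 < s" "s < h" and ps: "p h - p 0 =
      h * (iter_deriv [v] f ((x + h *\<^sub>R w) + s *\<^sub>R v) - iter_deriv [v] f (x + s *\<^sub>R v))" by auto
  have "\<exists>t. 0 < t \<and> t < h \<and> iter_deriv [v] f ((x + s *\<^sub>R v) + h *\<^sub>R w) - iter_deriv [v] f ((x + s *\<^sub>R v) + 0 *\<^sub>R w) =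
      (h - 0) * (iter_deriv [w] (iter_deriv [v] f) ((x + s *\<^sub>R v) + t *\<^sub>R w))"
    by (rule MVT2[OF h], rule D[OF smooth_on_iter_deriv[OF f]]) (use U s in auto)
  then obtain t where t: "0 < t" "t < h" "iter_deriv [v] f ((x + s *\<^sub>R v) + h *\<^sub>R w) - iter_deriv [v] f (x + s *\<^sub>R v) =
      h * (iter_deriv [w, v] f ((x + s *\<^sub>R v) + t *\<^sub>R w))"
    by auto
  have "p h - p 0 = h * (h * iter_deriv [w, v] f ((x + s *\<^sub>R v) + t *\<^sub>R w))"
    using ps t(3) by (simp add: algebra_simps)
  moreover have "p h - p 0 = f (x + h *\<^sub>R v + h *\<^sub>R w) - f (x + h *\<^sub>R v) - f (x + h *\<^sub>R w) + f x"
    unfolding p_def by (simp add: algebra_simps)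
  ultimately show ?thesis using that[OF s t(1,2)] by (simp add: power2_eq_square)
qed

lemma mixed_derivatives_commute:
  fixes f :: "'a::euclidean_space \<Rightarrow> real"
  assumes f: "smooth_on U f" and x: "x \<in> U"
  shows "iter_deriv [v, w] f x = iter_deriv [w, v] f x"
proof (rule ccontr)
  assume neq: "\<not> ?thesis"
  define a where "a = iter_deriv [v, w] f"
  define b where "b = iter_deriv [w, v] f"
  define \<epsilon> where "\<epsilon> = \<bar>a x - b x\<bar> / 2"
  have \<epsilon>: "\<epsilon> > 0" using neq by (simp add: \<epsilon>_def a_def b_def)
  have "continuous (at x) a" "continuous (at x) b"
    unfolding a_def b_def
    using smooth_on_imp_continuous_on[OF smooth_on_iter_deriv[OF f]] x smooth_on_openD[OF f]
      continuous_on_eq_continuous_at by blast+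
  then have "\<exists>da>0. \<forall>y. dist y x < da \<longrightarrow> dist (a y) (a x) < \<epsilon>"
    "\<exists>db>0. \<forall>y. dist y x < db \<longrightarrow> dist (b y) (b x) < \<epsilon>"
    using \<epsilon> unfolding continuous_at_eps_delta by (auto simp: dist_norm)
  then obtain da db where da: "da > 0" "\<And>y. dist y x < da \<Longrightarrow> dist (a y) (a x) < \<epsilon>"
    and db: "db > 0" "\<And>y. dist y x < db \<Longrightarrow> dist (b y) (b x) < \<epsilon>" by blast
  obtain dU where dU: "dU > 0" "\<And>y. dist y x < dU \<Longrightarrow> y \<in> U"
    using smooth_on_openD[OF f] x unfolding open_dist by blast
  define d where "d = min dU (min da db)"
  \<comment> \<open>The whole parallelogram with sides \<open>h\<close> times \<open>v\<close> and
    \<open>h\<close> times \<open>w\<close> then lies within \<open>d / 2\<close> of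
    \<open>x\<close>; the summand 1 keeps the denominator positive when both vectors vanish.\<close>
  define h where "h = d / (2 * (norm v + norm w + 1))"
  have d: "d > 0" using da db dU by (simp add: d_def)
  have nvw: "norm v + norm w + 1 > 0" using norm_ge_zero[of v] norm_ge_zero[of w] by linarith
  have h: "h > 0" using d nvw by (simp add: h_def)
  have near: "dist (x + s *\<^sub>R v + t *\<^sub>R w) x < d" if "0 \<le> s" "s \<le> h" "0 \<le> t" "t \<le> h" for s t
  proof -
    have "dist (x + s *\<^sub>R v + t *\<^sub>R w) x = norm (s *\<^sub>R v + t *\<^sub>R w)"
      by (simp add: dist_norm add.assoc)
    also have "\<dots> \<le> s * norm v + t * norm w"
      by (rule norm_triangle_le) (use that in simp)
    also have "\<dots> \<le> h * norm v + h * norm w"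
      using that by (intro add_mono mult_right_mono) auto
    also have "\<dots> \<le> h * (norm v + norm w + 1)" using h by (simp add: algebra_simps)
    also have "\<dots> = d / 2" using nvw by (simp add: h_def field_simps)
    also have "\<dots> < d" using d by simp
    finally show ?thesis .
  qed
  have inU: "x + s *\<^sub>R v + t *\<^sub>R w \<in> U" if "0 \<le> s" "s \<le> h" "0 \<le> t" "t \<le> h" for s t
    using near[OF that] dU by (simp add: d_def)
  obtain s t where st: "0 < s" "s < h" "0 < t" "t < h"
    "f (x + h *\<^sub>R v + h *\<^sub>R w) - f (x + h *\<^sub>R v) - f (x + h *\<^sub>R w) + f x = h\<^sup>2 * b (x + s *\<^sub>R v + t *\<^sub>R w)"
    using second_difference_mean_value[OF f h inU] unfolding b_def by blast
  have inU': "x + s *\<^sub>R w + t *\<^sub>R v \<in> U" if "0 \<le> s" "s \<le> h" "0 \<le> t" "t \<le> h" for s t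
    using inU[OF that(3,4,1,2)] by (simp add: algebra_simps)
  obtain s' t' where st': "0 < s'" "s' < h" "0 < t'" "t' < h"
    "f (x + h *\<^sub>R w + h *\<^sub>R v) - f (x + h *\<^sub>R w) - f (x + h *\<^sub>R v) + f x = h\<^sup>2 * a (x + s' *\<^sub>R w + t' *\<^sub>R v)"
    using second_difference_mean_value[OF f h inU'] unfolding a_def by blast
  \<comment> \<open>Both sides are the same second difference, once with the roles of
    \<open>v\<close> and \<open>w\<close> exchanged.\<close>
  have "h\<^sup>2 * a (x + s' *\<^sub>R w + t' *\<^sub>R v) = h\<^sup>2 * b (x + s *\<^sub>R v + t *\<^sub>R w)"
    using st(5) st'(5) unfolding add.assoc add.commute[of "h *\<^sub>R v"] by linarith
  then have "a (x + s' *\<^sub>R w + t' *\<^sub>R v) = b (x + s *\<^sub>R v + t *\<^sub>R w)"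
    using h by simp
  then have eq: "a (x + t' *\<^sub>R v + s' *\<^sub>R w) = b (x + s *\<^sub>R v + t *\<^sub>R w)"
    by (simp add: add_ac)
  have "dist (a (x + t' *\<^sub>R v + s' *\<^sub>R w)) (a x) < \<epsilon>"
    using near[of t' s'] st' by (intro da(2)) (simp add: d_def)
  moreover have "dist (b (x + s *\<^sub>R v + t *\<^sub>R w)) (b x) < \<epsilon>"
    using near[of s t] st by (intro db(2)) (simp add: d_def)
  ultimately have "dist (a x) (b x) < 2 * \<epsilon>"
    using eq dist_triangle2[of "a x" "b x" "b (x + s *\<^sub>R v + t *\<^sub>R w)"] by (simp add: dist_commute)
  then show False by (simp add: \<epsilon>_def dist_real_def)
qed

section \<open>The Hermitian product and the complex tangencies\<close>

text \<open>Conjugate-linear in the first argument. The real part is the Euclidean inner product,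
  and the imaginary part, \<open>(\<i> *s x) \<bullet> y\<close>, is the standard symplectic form;
  the latter is written in this real form throughout.\<close>

definition hip :: "complex ^ 'k::finite \<Rightarrow> complex ^ 'k \<Rightarrow> complex" where
  "hip x y = (\<Sum>i\<in>UNIV. cnj (x $ i) * y $ i)"

lemma inner_eq_Re_hip: "x \<bullet> y = Re (hip x y)"
  by (simp add: hip_def inner_vec_def inner_complex_def)

lemma hip_add_right: "hip x (y + z) = hip x y + hip x z"
  and hip_diff_right: "hip x (y - z) = hip x y - hip x z"
  and hip_scale_left: "hip (c *s x) y = cnj c * hip x y"
  and hip_scale_right: "hip x (c *s y) = c * hip x y"
  and hip_sum_right: "hip x (\<Sum>i\<in>I. f i) = (\<Sum>i\<in>I. hip x (f i))"
proof -
  show "hip x (\<Sum>i\<in>I. f i) = (\<Sum>i\<in>I. hip x (f i))"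
    unfolding hip_def by (subst sum.swap) (simp add: sum_distrib_left)
qed (simp_all add: hip_def sum.distrib sum_subtractf sum_distrib_left algebra_simps)

lemma cnj_hip: "cnj (hip x y) = hip y x"
  by (simp add: hip_def mult.commute)

lemma hip_self: "hip x x = of_real ((norm x)\<^sup>2)"
proof -
  have "Im (hip x x) = 0" using cnj_hip[of x x] by (simp add: complex_eq_iff)
  then show ?thesis by (simp add: complex_eq_iff power2_norm_eq_inner inner_eq_Re_hip)
qed

lemma hip_eq_0_iff: "hip x y = 0 \<longleftrightarrow> x \<bullet> y = 0 \<and> (\<i> *s x) \<bullet> y = 0"
  by (simp add: inner_eq_Re_hip hip_scale_left complex_eq_iff)

lemma inner_imult_self: "(\<i> *s x) \<bullet> (\<i> *s y) = x \<bullet> y"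
  by (simp add: inner_eq_Re_hip hip_scale_left hip_scale_right)

lemma inner_imult_skew: "(\<i> *s x) \<bullet> y = - ((\<i> *s y) \<bullet> x)"
  by (simp add: inner_eq_Re_hip hip_scale_left cnj_hip[of x y, symmetric])

lemma imult_imult: "\<i> *s (\<i> *s x) = - x"
  by (simp add: vec_eq_iff)

lemma bounded_linear_imult: "bounded_linear (\<lambda>x. c *s x :: complex ^ 'k::finite)"
  unfolding linear_conv_bounded_linear[symmetric]
  by (rule linearI) (simp_all add: vec_eq_iff algebra_simps)

section \<open>Great circles, tangent spaces and contact hyperplanes of the sphere\<close>

lemma smooth_map_onI_UNIV:
  "smooth_on UNIV g \<Longrightarrow> (\<And>z. z \<in> S \<Longrightarrow> g z = f z) \<Longrightarrow> smooth_map_on S f"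
  unfolding smooth_map_on_def by (metis IntD1 UNIV_I)

text \<open>Differentiation maps the span of cosine and sine, with vector coefficients, into itself;
  so one shape covers derivatives of every order.\<close>

lemma iter_deriv_circle:
  fixes a b :: "'a::euclidean_space"
  shows "\<exists>a' b'. iter_deriv vs (\<lambda>t. cos (c * t) *\<^sub>R a + sin (c * t) *\<^sub>R b) =
    (\<lambda>t::real. cos (c * t) *\<^sub>R a' + sin (c * t) *\<^sub>R b')"
proof (induction vs)
  case (Cons v vs)
  then obtain a' b' where ab: "iter_deriv vs (\<lambda>t. cos (c * t) *\<^sub>R a + sin (c * t) *\<^sub>R b) =
    (\<lambda>t::real. cos (c * t) *\<^sub>R a' + sin (c * t) *\<^sub>R b')" by blast
  have "((\<lambda>t::real. cos (c * t) *\<^sub>R a' + sin (c * t) *\<^sub>R b') has_derivative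
      (\<lambda>h. (cos (c * t) * h * c) *\<^sub>R b' + (- sin (c * t) * h * c) *\<^sub>R a')) (at t)" for t
    by (auto intro!: derivative_eq_intros simp: algebra_simps)
  note fr = frechet_derivative_at[OF this, symmetric]
  have "iter_deriv (v # vs) (\<lambda>t. cos (c * t) *\<^sub>R a + sin (c * t) *\<^sub>R b) =
    (\<lambda>t. cos (c * t) *\<^sub>R ((v * c) *\<^sub>R b') + sin (c * t) *\<^sub>R (- (v * c) *\<^sub>R a'))"
    by (simp add: ab fr fun_eq_iff mult.assoc)
  then show ?case by blast
qed auto

lemma smooth_on_circle:
  fixes a b :: "'a::euclidean_space"
  shows "smooth_on UNIV (\<lambda>t::real. cos (c * t) *\<^sub>R a + sin (c * t) *\<^sub>R b)"
  unfolding smooth_on_def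
proof (intro conjI allI ballI)
  fix vs and t :: real
  obtain a' b' where "iter_deriv vs (\<lambda>t. cos (c * t) *\<^sub>R a + sin (c * t) *\<^sub>R b) =
    (\<lambda>t::real. cos (c * t) *\<^sub>R a' + sin (c * t) *\<^sub>R b')" using iter_deriv_circle by blast
  moreover have "((\<lambda>t::real. cos (c * t) *\<^sub>R a' + sin (c * t) *\<^sub>R b') has_derivative
      (\<lambda>h. (cos (c * t) * h * c) *\<^sub>R b' + (- sin (c * t) * h * c) *\<^sub>R a')) (at t)"
    by (auto intro!: derivative_eq_intros simp: algebra_simps)
  ultimately show "iter_deriv vs (\<lambda>t. cos (c * t) *\<^sub>R a + sin (c * t) *\<^sub>R b) differentiable at t"
    by (auto simp: differentiable_def)
qed simp

text \<open>Differentiate the constant function \<open>f y \<bullet> f y\<close>. This serves both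
  curves on the sphere and charts of it.\<close>

lemma inner_eq_0_of_sphere_valued:
  fixes f :: "'a::euclidean_space \<Rightarrow> 'b::euclidean_space"
  assumes f: "(f has_derivative D) (at x)" and U: "open U" "x \<in> U" "f ` U \<subseteq> sphere 0 1"
  shows "f x \<bullet> D v = 0"
proof -
  have "((\<lambda>y. f y \<bullet> f y) has_derivative (\<lambda>v. f x \<bullet> D v + D v \<bullet> f x)) (at x)"
    by (intro has_derivative_inner f)
  then have "((\<lambda>y. 1::real) has_derivative (\<lambda>v. f x \<bullet> D v + D v \<bullet> f x)) (at x)"
    by (rule has_derivative_transform_within_open[OF _ U(1,2)]) (use U(3) in \<open>auto simp: dot_square_norm\<close>)
  then have "(\<lambda>v. f x \<bullet> D v + D v \<bullet> f x) = (\<lambda>v. 0)"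
    using has_derivative_unique has_derivative_const by blast
  from fun_cong[OF this, of v] show ?thesis by (simp add: inner_commute)
qed

lemma tangent_space_sphere:
  fixes z :: "'a::euclidean_space"
  assumes z: "z \<in> sphere 0 1"
  shows "tangent_space (sphere 0 1) z = {v. z \<bullet> v = 0}"
proof (intro equalityI subsetI)
  fix v assume "v \<in> tangent_space (sphere 0 1) z"
  then obtain \<gamma> :: "real \<Rightarrow> 'a" where \<gamma>: "range \<gamma> \<subseteq> sphere 0 1" "\<gamma> 0 = z"
    "(\<gamma> has_derivative (\<lambda>r. r *\<^sub>R v)) (at 0)"
    unfolding tangent_space_def has_vector_derivative_def by auto
  then show "v \<in> {v. z \<bullet> v = 0}"
    using inner_eq_0_of_sphere_valued[OF \<gamma>(3) open_UNIV, of 1] by simp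
next
  fix v assume "v \<in> {v. z \<bullet> v = 0}"
  then have zv: "z \<bullet> v = 0" by simp
  have nz: "norm z = 1" using z by simp
  define c where "c = norm v"
  \<comment> \<open>The great circle through \<open>z\<close> traversed with speed
    \<open>norm v\<close>. For \<open>v = 0\<close> the quotient \<open>1 / c\<close> is 0 and the
    curve is constant.\<close>
  define \<gamma> where "\<gamma> = (\<lambda>t. cos (c * t) *\<^sub>R z + sin (c * t) *\<^sub>R ((1 / c) *\<^sub>R v))"
  have "\<gamma> t \<bullet> \<gamma> t = 1" if "c \<noteq> 0" for t
  proof -
    have "norm ((1 / c) *\<^sub>R v) = 1" using that unfolding c_def by simp
    then have unit: "((1 / c) *\<^sub>R v) \<bullet> ((1 / c) *\<^sub>R v) = 1"
      by (simp only: dot_square_norm power_one)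
    have "\<gamma> t \<bullet> \<gamma> t = (cos (c * t))\<^sup>2 * (z \<bullet> z) + (sin (c * t))\<^sup>2 * (((1 / c) *\<^sub>R v) \<bullet> ((1 / c) *\<^sub>R v))"
      using zv by (simp add: \<gamma>_def inner_add_left inner_add_right inner_commute power2_eq_square)
    moreover have "z \<bullet> z = 1" using nz by (simp add: dot_square_norm)
    ultimately show ?thesis unfolding unit by simp
  qed
  moreover have "\<gamma> t \<bullet> \<gamma> t = 1" if "c = 0" for t
    using that nz by (simp add: \<gamma>_def dot_square_norm)
  ultimately have "\<gamma> t \<bullet> \<gamma> t = 1" for t by blast
  then have "range \<gamma> \<subseteq> sphere 0 1"
    by (auto simp: norm_eq_sqrt_inner)
  moreover have "(\<gamma> has_vector_derivative v) (at 0)"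
  proof -
    have "((\<lambda>t. cos (c * t) *\<^sub>R z + sin (c * t) *\<^sub>R w) has_derivative (\<lambda>h. (h * c) *\<^sub>R w)) (at 0)" for w
      by (auto intro!: derivative_eq_intros simp: algebra_simps)
    from this[of "(1 / c) *\<^sub>R v"]
    have "(\<gamma> has_derivative (\<lambda>h. (h * c) *\<^sub>R ((1 / c) *\<^sub>R v))) (at 0)" by (simp only: \<gamma>_def)
    moreover have "(h * c) *\<^sub>R ((1 / c) *\<^sub>R v) = h *\<^sub>R v" for h
      by (cases "c = 0") (auto simp: c_def)
    ultimately show ?thesis by (simp only: has_vector_derivative_def)
  qed
  moreover have "smooth_on UNIV \<gamma>" unfolding \<gamma>_def by (rule smooth_on_circle)
  moreover have "\<gamma> 0 = z" by (simp add: \<gamma>_def)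
  ultimately show "v \<in> tangent_space (sphere 0 1) z"
    unfolding tangent_space_def by blast
qed

lemma contact_structure_eq:
  fixes z :: "('n::finite) cvec"
  assumes "z \<in> unit_sphere"
  shows "contact_structure z = {v. hip z v = 0}"
proof -
  \<comment> \<open>A vector lies in \<open>\<i>\<close> times the tangent space iff it is
    orthogonal to \<open>\<i> *s z\<close>. Together with orthogonality to \<open>z\<close> this is
    vanishing of the Hermitian product.\<close>
  have "v \<in> (\<lambda>v. \<i> *s v) ` {v. z \<bullet> v = 0} \<longleftrightarrow> (\<i> *s z) \<bullet> v = 0" for v
  proof
    assume "(\<i> *s z) \<bullet> v = 0"
    moreover have "v = \<i> *s (- (\<i> *s v))" by (simp add: vec_eq_iff)
    moreover have "z \<bullet> (- (\<i> *s v)) = (\<i> *s z) \<bullet> v"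
      by (simp add: inner_imult_skew[of z v] inner_commute[of z "\<i> *s v"])
    ultimately show "v \<in> (\<lambda>v. \<i> *s v) ` {v. z \<bullet> v = 0}"
      by (intro image_eqI[where x="- (\<i> *s v)"]) auto
  qed (auto simp: inner_imult_self)
  then show ?thesis
    unfolding contact_structure_def tangent_space_sphere[OF assms] by (auto simp: hip_eq_0_iff)
qed

text \<open>The index type has at least two elements, so a complex hyperplane is not 0. Such a
  vector is what later shows that the conformal factor is nonzero.\<close>

lemma contact_structure_nonzero:
  fixes z :: "('n::finite) cvec"
  assumes "z \<in> unit_sphere"
  obtains p where "p \<in> contact_structure z" "p \<noteq> 0"
proof -
  obtain a b :: "'n option" where ab: "a \<noteq> b" 
    by (rule that[of None "Some undefined"]) simp
  \<comment> \<open>The two terms of \<open>hip z p\<close> cancel. If \<open>p\<close> is 0, then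
    the coordinate of \<open>z\<close> at \<open>a\<close> vanishes and a basis vector serves
    instead.\<close>
  define p where "p = (\<chi> i. if i = a then cnj (z $ b) else if i = b then - cnj (z $ a) else 0)"
  have "hip z p = (\<Sum>i\<in>{a, b}. cnj (z $ i) * p $ i)"
    unfolding hip_def by (rule sum.mono_neutral_right) (auto simp: p_def)
  also have "\<dots> = 0" using ab by (simp add: p_def)
  finally have p: "hip z p = 0" .
  show ?thesis
  proof (cases "p = 0")
    case True
    then have "p $ b = 0" by simp
    then have "z $ a = 0" using ab by (simp add: p_def)
    moreover have "hip z (axis a 1) = (\<Sum>i\<in>{a}. cnj (z $ i) * axis a 1 $ i)"
      unfolding hip_def by (rule sum.mono_neutral_right) (auto simp: axis_def)
    ultimately have "hip z (axis a 1) = 0" by simp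
    then show ?thesis using that[of "axis a 1"] contact_structure_eq[OF assms] by (simp add: axis_eq_0_iff)
  next
    case False
    then show ?thesis using p that contact_structure_eq[OF assms] by blast
  qed
qed

section \<open>A chart around the base point\<close>

definition base_point :: "('n::finite) cvec" where "base_point = axis None 1"

text \<open>An isometry onto the real orthogonal complement of \<open>base_point\<close>, that is,
  onto the vectors whose \<open>None\<close> coordinate is purely imaginary.\<close>

definition to_tangent :: "('n::finite) chart_space \<Rightarrow> 'n cvec" where
  "to_tangent x = (\<chi> i. case i of None \<Rightarrow> Complex 0 (x $ Inr None)
     | Some k \<Rightarrow> Complex (x $ Inl k) (x $ Inr (Some k)))"

definition from_tangent :: "('n::finite) cvec \<Rightarrow> 'n chart_space" where
  "from_tangent z = (\<chi> s. case s of Inl k \<Rightarrow> Re (z $ Some k) | Inr i \<Rightarrow> Im (z $ i))"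

text \<open>The open hemisphere around \<open>base_point\<close> as a graph over its tangent
  space.\<close>

definition graph_chart :: "('n::finite) chart_space \<Rightarrow> 'n cvec" where
  "graph_chart x = to_tangent x + sqrt (1 - x \<bullet> x) *\<^sub>R base_point"

lemma bounded_linear_to_tangent: "bounded_linear to_tangent"
  unfolding linear_conv_bounded_linear[symmetric]
  by (rule linearI) (auto simp: vec_eq_iff to_tangent_def complex_eq_iff split: option.splits)

lemma bounded_linear_from_tangent: "bounded_linear from_tangent"
  unfolding linear_conv_bounded_linear[symmetric]
  by (rule linearI) (auto simp: vec_eq_iff from_tangent_def split: sum.splits)

lemma from_to_tangent: "from_tangent (to_tangent x) = x"
  by (auto simp: vec_eq_iff to_tangent_def from_tangent_def split: sum.splits option.splits)

lemma from_tangent_base_point: "from_tangent base_point = 0"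
  by (auto simp: vec_eq_iff base_point_def axis_def from_tangent_def split: sum.splits)

lemma to_from_tangent: "to_tangent (from_tangent z) = z - Re (z $ None) *\<^sub>R base_point"
  by (auto simp: vec_eq_iff to_tangent_def from_tangent_def base_point_def axis_def complex_eq_iff split: option.splits)

lemma hip_base_point: "hip base_point z = z $ None"
proof -
  have "hip base_point z = (\<Sum>i\<in>{None}. cnj (base_point $ i) * z $ i)"
    unfolding hip_def by (rule sum.mono_neutral_right) (auto simp: base_point_def axis_def)
  then show ?thesis by (simp add: base_point_def)
qed

lemma base_point_inner_to_tangent: "base_point \<bullet> to_tangent x = 0"
  and to_tangent_inner_base_point: "to_tangent x \<bullet> base_point = 0"
proof -
  show "base_point \<bullet> to_tangent x = 0"
    by (simp add: inner_eq_Re_hip hip_base_point to_tangent_def)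
  then show "to_tangent x \<bullet> base_point = 0" by (simp add: inner_commute)
qed

lemma norm_base_point: "norm base_point = 1"
  by (simp add: base_point_def norm_axis_1)

lemma base_point_in_sphere: "base_point \<in> unit_sphere"
  by (simp add: norm_base_point)

lemma base_point_inner_self: "base_point \<bullet> base_point = 1"
  by (simp add: dot_square_norm norm_base_point)

lemma inner_to_tangent: "to_tangent x \<bullet> to_tangent x = x \<bullet> x"
proof -
  have *: "(\<Sum>i\<in>UNIV. g i) = g None + (\<Sum>k\<in>UNIV. g (Some k))" for g :: "'a option \<Rightarrow> real"
    by (simp add: UNIV_option_conv sum.reindex)
  have "(\<Sum>s\<in>UNIV. x $ s * x $ s) = (\<Sum>k\<in>UNIV. x $ Inl k * x $ Inl k) + (\<Sum>i\<in>UNIV. x $ Inr i * x $ Inr i)"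
    by (simp add: sum.Plus UNIV_Plus_UNIV[symmetric] del: UNIV_Plus_UNIV)
  then show ?thesis
    by (simp add: inner_vec_def to_tangent_def inner_complex_def * sum.distrib)
qed

lemma graph_chart_None: "Re (graph_chart x $ None) = sqrt (1 - x \<bullet> x)"
  by (simp add: graph_chart_def to_tangent_def base_point_def)

lemma from_tangent_graph_chart: "from_tangent (graph_chart x) = x"
proof -
  interpret bounded_linear from_tangent by (rule bounded_linear_from_tangent)
  show ?thesis by (simp add: graph_chart_def add scaleR from_to_tangent from_tangent_base_point)
qed

lemma graph_chart_in_sphere:
  fixes x :: "('n::finite) chart_space"
  shows "x \<in> ball 0 1 \<Longrightarrow> graph_chart x \<in> unit_sphere"
proof -
  assume "x \<in> ball 0 1"
  then have "x \<bullet> x < 1" by (simp add: dot_square_norm abs_square_less_1)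
  then have "graph_chart x \<bullet> graph_chart x = 1"
    by (simp add: graph_chart_def inner_add_left inner_add_right inner_to_tangent
        base_point_inner_self
        base_point_inner_to_tangent to_tangent_inner_base_point)
  then show ?thesis by (simp add: norm_eq_sqrt_inner)
qed

lemma graph_chart_image:
  "graph_chart ` ball 0 1 = {z \<in> (unit_sphere :: ('n::finite) cvec set). Re (z $ None) > 0}"
proof (intro equalityI subsetI)
  fix z :: "'n cvec" assume "z \<in> graph_chart ` ball 0 1"
  then obtain x where x: "z = graph_chart x" "x \<in> ball 0 1" by blast
  then have "x \<bullet> x < 1" by (simp add: dot_square_norm abs_square_less_1)
  with x graph_chart_in_sphere[OF x(2)] show "z \<in> {z \<in> unit_sphere. Re (z $ None) > 0}"
    by (simp add: graph_chart_None)
next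
  fix z :: "'n cvec" assume "z \<in> {z \<in> unit_sphere. Re (z $ None) > 0}"
  then have nz: "norm z = 1" and pos: "Re (z $ None) > 0" by simp_all
  define x where "x = from_tangent z"
  have z: "z = to_tangent x + Re (z $ None) *\<^sub>R base_point" by (simp add: x_def to_from_tangent)
  have "z \<bullet> z = x \<bullet> x + (Re (z $ None))\<^sup>2"
    by (subst (1 2) z) (simp add: inner_add_left inner_add_right inner_to_tangent
        base_point_inner_self
        base_point_inner_to_tangent to_tangent_inner_base_point power2_eq_square)
  then have xx: "1 - x \<bullet> x = (Re (z $ None))\<^sup>2" using nz by (simp add: dot_square_norm)
  then have "z = graph_chart x" using z pos by (simp add: graph_chart_def)
  moreover have "norm x < 1"
  proof -
    have "0 < (Re (z $ None))\<^sup>2" using pos by simp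
    then have "(norm x)\<^sup>2 < 1" using xx unfolding dot_square_norm by linarith
    then show ?thesis by (simp add: abs_square_less_1)
  qed
  ultimately show "z \<in> graph_chart ` ball 0 1" by simp
qed

lemma graph_chart_0: "graph_chart 0 = base_point"
  using linear_0[OF bounded_linear.linear[OF bounded_linear_to_tangent]] by (simp add: graph_chart_def)

lemma smooth_on_graph_chart: "smooth_on (ball 0 1) (graph_chart :: ('n::finite) chart_space \<Rightarrow> _)"
  unfolding smooth_on_iff_ksmooth
proof
  fix k
  \<comment> \<open>The function under the root, built from sums and products only so that the
    closure rules apply; the root itself becomes a power with exponent \<open>1/2\<close>.\<close>
  have h: "ksmooth_on k (ball 0 1) (\<lambda>x::'n chart_space. 1 + (x \<bullet> x) *\<^sub>R (-1::real))" for k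
  proof (intro ksmooth_on_add ksmooth_on_scaleR ksmooth_on_const open_ball)
    show "ksmooth_on k (ball 0 1) (\<lambda>x::'n chart_space. x \<bullet> x)"
    proof (rule ksmooth_on_cong)
      show "ksmooth_on k (ball 0 1) (\<lambda>x::'n chart_space. \<Sum>b\<in>Basis. (x \<bullet> b) *\<^sub>R (x \<bullet> b))"
        by (intro ksmooth_on_sum ksmooth_on_scaleR ksmooth_on_linear bounded_linear_inner_left open_ball)
    qed (simp only: real_scaleR_def euclidean_inner[symmetric])
  qed
  have "1 + (x \<bullet> x) *\<^sub>R (-1::real) > 0" if "x \<in> ball 0 1" for x :: "'n chart_space"
    using that by (simp add: dot_square_norm abs_square_less_1)
  then have "ksmooth_on k (ball 0 1) (\<lambda>x::'n chart_space. (1 + (x \<bullet> x) *\<^sub>R (-1::real)) powr (1/2))"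
    by (rule ksmooth_on_powr[OF h])
  from ksmooth_on_add[OF ksmooth_on_linear[OF bounded_linear_to_tangent open_ball]
      ksmooth_on_scaleR[OF this ksmooth_on_const[OF open_ball]]]
  have "ksmooth_on k (ball 0 1) (\<lambda>x::'n chart_space. to_tangent x + (1 + (x \<bullet> x) *\<^sub>R (-1::real)) powr (1/2) *\<^sub>R base_point)" .
  then show "ksmooth_on k (ball 0 1) (graph_chart :: 'n chart_space \<Rightarrow> _)"
    by (rule ksmooth_on_cong[rotated])
       (simp add: graph_chart_def powr_half_sqrt dot_square_norm power_le_one)
qed

text \<open>The image is the part of the sphere where the real part of the \<open>None\<close>
  coordinate is positive, and the inverse is a restriction of the linear map
  \<open>from_tangent\<close>.\<close>

lemma local_parametrization_graph_chart:
  "local_parametrization unit_sphere (ball 0 1) (graph_chart :: ('n::finite) chart_space \<Rightarrow> _)"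
  unfolding local_parametrization_def
proof (intro conjI)
  show inj: "inj_on graph_chart (ball 0 1 :: 'n chart_space set)"
    by (rule inj_on_inverseI[where g=from_tangent]) (rule from_tangent_graph_chart)
  have "open {z :: 'n cvec. Re (z $ None) > 0}"
    by (intro open_Collect_less continuous_intros)
  moreover have "graph_chart ` (ball 0 1 :: 'n chart_space set) = unit_sphere \<inter> {z :: 'n cvec. Re (z $ None) > 0}"
    unfolding graph_chart_image by blast
  ultimately show "openin (top_of_set unit_sphere) (graph_chart ` (ball 0 1 :: 'n chart_space set) :: 'n cvec set)"
    by (metis openin_open)
  show "smooth_map_on (graph_chart ` (ball 0 1 :: 'n chart_space set)) (inv_into (ball 0 1 :: 'n chart_space set) graph_chart)"
  proof (rule smooth_map_onI_UNIV)
    show "smooth_on UNIV (from_tangent :: 'n cvec \<Rightarrow> _)"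
      by (rule smooth_on_linear[OF bounded_linear_from_tangent open_UNIV])
    fix z :: "'n cvec" assume "z \<in> graph_chart ` (ball 0 1 :: 'n chart_space set)"
    then show "from_tangent z = inv_into (ball 0 1 :: 'n chart_space set) graph_chart z"
      using inj by (auto simp: from_tangent_graph_chart)
  qed
qed (rule smooth_on_graph_chart)

text \<open>The square root is stationary at 0, so to first order the chart is the linear inclusion
  of the tangent space.\<close>

lemma has_derivative_graph_chart_0:
  "((graph_chart :: ('n::finite) chart_space \<Rightarrow> _) has_derivative to_tangent) (at 0)"
proof -
  have "((\<lambda>x::'n chart_space. 1 - x \<bullet> x) has_derivative (\<lambda>v. 0)) (at 0)"
    by (auto intro!: derivative_eq_intros)
  then have "((\<lambda>x::'n chart_space. sqrt (1 - x \<bullet> x)) has_derivative (\<lambda>v. 0)) (at 0)"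
    by (auto intro!: derivative_eq_intros)
  then have "((\<lambda>x::'n chart_space. to_tangent x + sqrt (1 - x \<bullet> x) *\<^sub>R base_point) has_derivative (\<lambda>v. to_tangent v + 0 *\<^sub>R base_point)) (at 0)"
    by (intro has_derivative_add bounded_linear_imp_has_derivative bounded_linear_to_tangent
       has_derivative_scaleR_left)
  then show ?thesis by (simp add: graph_chart_def[abs_def])
qed

section \<open>Contactomorphisms are conformally symplectic on the contact structure\<close>

lemma linear_iter_deriv_single:
  assumes "smooth_on U f" "x \<in> U"
  shows "linear (\<lambda>v. iter_deriv [v] f x)"
  using smooth_on_has_derivative[OF assms] by (rule has_derivative_linear)

text \<open>For a map \<open>F\<close> into complex space, \<open>(\<i> *s F x) \<bullet> iter_deriv [w] F x\<close> is the pullback of the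
  standard contact form. Its exterior derivative is twice the pullback of the symplectic form.\<close>

lemma has_derivative_pullback_form:
  fixes F :: "'a::euclidean_space \<Rightarrow> complex ^ 'k::finite"
  assumes F: "smooth_on U F" and x: "x \<in> U"
  shows "((\<lambda>y. (\<i> *s F y) \<bullet> iter_deriv [w] F y) has_derivative
    (\<lambda>v. (\<i> *s F x) \<bullet> iter_deriv [v, w] F x + (\<i> *s iter_deriv [v] F x) \<bullet> iter_deriv [w] F x)) (at x)"
proof -
  have "((\<lambda>y. iter_deriv [w] F y) has_derivative (\<lambda>v. iter_deriv [v] (iter_deriv [w] F) x)) (at x)"
    by (rule smooth_on_has_derivative[OF smooth_on_iter_deriv[OF F] x])
  moreover have "((\<lambda>y. \<i> *s F y) has_derivative (\<lambda>v. \<i> *s iter_deriv [v] F x)) (at x)"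
    by (rule bounded_linear.has_derivative[OF bounded_linear_imult smooth_on_has_derivative[OF F x]])
  ultimately show ?thesis using has_derivative_inner by fastforce
qed

lemma inner_mixed_derivatives_commute:
  fixes F :: "'a::euclidean_space \<Rightarrow> 'b::euclidean_space"
  assumes F: "smooth_on U F" and x: "x \<in> U"
  shows "a \<bullet> iter_deriv [v, w] F x = a \<bullet> iter_deriv [w, v] F x"
proof -
  have bl: "bounded_linear (\<lambda>y. a \<bullet> y)" by (rule bounded_linear_inner_right)
  have "smooth_on U (\<lambda>y. a \<bullet> F y)"
    using F ksmooth_on_compose_linear[OF bl] unfolding smooth_on_iff_ksmooth by blast
  from mixed_derivatives_commute[OF this x, of v w] show ?thesis
    by (simp only: iter_deriv_compose_linear[OF bl F x])
qed

text \<open>Let \<alpha> and \<beta> be the pullbacks of the contact form by \<open>F\<close> and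
  \<open>G\<close>. Kernel inclusion makes \<alpha> a pointwise multiple of \<beta>; differentiating
  this relation and antisymmetrising makes their exterior derivatives proportional on the kernel of
  \<beta>. The direction \<open>r\<close>, transverse to that kernel, determines the factor. Later
  \<open>G\<close> is the chart and \<open>F\<close> the chart followed by a
  contactomorphism.\<close>

lemma conformal_of_kernel_inclusion:
  fixes F :: "'a::euclidean_space \<Rightarrow> complex ^ 'k::finite" and G :: "'a \<Rightarrow> complex ^ 'l::finite"
  assumes F: "smooth_on U F" and G: "smooth_on U G" and x: "x \<in> U"
    and ker: "\<And>y v. y \<in> U \<Longrightarrow> (\<i> *s G y) \<bullet> iter_deriv [v] G y = 0 \<Longrightarrow> (\<i> *s F y) \<bullet> iter_deriv [v] F y = 0"
    and r: "(\<i> *s G x) \<bullet> iter_deriv [r] G x \<noteq> 0"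
  shows "\<exists>\<mu>. \<forall>v w. (\<i> *s G x) \<bullet> iter_deriv [v] G x = 0 \<longrightarrow> (\<i> *s G x) \<bullet> iter_deriv [w] G x = 0 \<longrightarrow>
    (\<i> *s iter_deriv [v] F x) \<bullet> iter_deriv [w] F x = \<mu> * ((\<i> *s iter_deriv [v] G x) \<bullet> iter_deriv [w] G x)"
proof -
  define \<alpha> where "\<alpha> = (\<lambda>y v. (\<i> *s F y) \<bullet> iter_deriv [v] F y)"
  define \<beta> where "\<beta> = (\<lambda>y v. (\<i> *s G y) \<bullet> iter_deriv [v] G y)"
  define \<alpha>' where "\<alpha>' = (\<lambda>w v. (\<i> *s F x) \<bullet> iter_deriv [v, w] F x + (\<i> *s iter_deriv [v] F x) \<bullet> iter_deriv [w] F x)"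
  define \<beta>' where "\<beta>' = (\<lambda>w v. (\<i> *s G x) \<bullet> iter_deriv [v, w] G x + (\<i> *s iter_deriv [v] G x) \<bullet> iter_deriv [w] G x)"
  have \<alpha>': "((\<lambda>y. \<alpha> y w) has_derivative \<alpha>' w) (at x)" for w
    unfolding \<alpha>_def \<alpha>'_def by (rule has_derivative_pullback_form[OF F x])
  have \<beta>': "((\<lambda>y. \<beta> y w) has_derivative \<beta>' w) (at x)" for w
    unfolding \<beta>_def \<beta>'_def by (rule has_derivative_pullback_form[OF G x])
  have skew_\<alpha>: "\<alpha>' w v - \<alpha>' v w = 2 * ((\<i> *s iter_deriv [v] F x) \<bullet> iter_deriv [w] F x)" for v w
    unfolding \<alpha>'_def inner_mixed_derivatives_commute[OF F x, of _ w v]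
      inner_imult_skew[of "iter_deriv [w] F x" "iter_deriv [v] F x"] by simp
  have skew_\<beta>: "\<beta>' w v - \<beta>' v w = 2 * ((\<i> *s iter_deriv [v] G x) \<bullet> iter_deriv [w] G x)" for v w
    unfolding \<beta>'_def inner_mixed_derivatives_commute[OF G x, of _ w v]
      inner_imult_skew[of "iter_deriv [w] G x" "iter_deriv [v] G x"] by simp
  \<comment> \<open>Proportionality without division: this form also holds at points where
    \<open>\<beta> y r\<close> vanishes, and it can be differentiated with no knowledge of the
    factor.\<close>
  have prp: "\<alpha> y w * \<beta> y r = \<alpha> y r * \<beta> y w" if "y \<in> U" for y w
  proof (cases "\<beta> y r = 0")
    case True
    then show ?thesis using ker[OF that] by (simp add: \<alpha>_def \<beta>_def)
  next
    case False
    \<comment> \<open>Subtracting this multiple of \<open>r\<close> moves \<open>w\<close> into the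
      kernel of \<open>\<beta> y\<close>.\<close>
    define c where "c = \<beta> y w / \<beta> y r"
    have "linear (\<lambda>v. \<alpha> y v)" "linear (\<lambda>v. \<beta> y v)"
      using linear_compose[OF linear_iter_deriv_single[OF F that] bounded_linear.linear[OF bounded_linear_inner_right]]
        linear_compose[OF linear_iter_deriv_single[OF G that] bounded_linear.linear[OF bounded_linear_inner_right]]
      unfolding \<alpha>_def \<beta>_def by (simp_all add: o_def)
    then have 1: "\<alpha> y (w - c *\<^sub>R r) = \<alpha> y w - c * \<alpha> y r" "\<beta> y (w - c *\<^sub>R r) = \<beta> y w - c * \<beta> y r"
      by (simp_all add: linear_diff linear_cmul)
    have "\<beta> y (w - c *\<^sub>R r) = 0" using False unfolding 1 by (simp add: c_def)
    then have "\<alpha> y (w - c *\<^sub>R r) = 0" using ker[OF that] unfolding \<alpha>_def \<beta>_def by blast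
    then show ?thesis using False unfolding 1 by (simp add: c_def field_simps)
  qed
  \<comment> \<open>Product rule for \<open>prp\<close>; the terms containing
    \<open>\<beta> x w\<close> and \<open>\<alpha> x w\<close> drop out.\<close>
  have key: "\<alpha>' w v * \<beta> x r = \<alpha> x r * \<beta>' w v" if w: "\<beta> x w = 0" for v w
  proof -
    have "\<alpha> x w = 0" using w ker[OF x] unfolding \<alpha>_def \<beta>_def by blast
    have d1: "((\<lambda>y. \<alpha> y w * \<beta> y r) has_derivative (\<lambda>v. \<alpha> x w * \<beta>' r v + \<alpha>' w v * \<beta> x r)) (at x)"
      by (intro has_derivative_mult \<alpha>' \<beta>')
    have "((\<lambda>y. \<alpha> y r * \<beta> y w) has_derivative (\<lambda>v. \<alpha> x r * \<beta>' w v + \<alpha>' r v * \<beta> x w)) (at x)"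
      by (intro has_derivative_mult \<alpha>' \<beta>')
    then have "((\<lambda>y. \<alpha> y w * \<beta> y r) has_derivative (\<lambda>v. \<alpha> x r * \<beta>' w v + \<alpha>' r v * \<beta> x w)) (at x)"
      by (rule has_derivative_transform_within_open[OF _ smooth_on_openD[OF F] x]) (simp add: prp)
    from fun_cong[OF has_derivative_unique[OF d1 this], of v]
    show ?thesis using w \<open>\<alpha> x w = 0\<close> by simp
  qed
  have "\<beta> x r \<noteq> 0" using r by (simp add: \<beta>_def)
  show ?thesis
  proof (intro exI[of _ "\<alpha> x r / \<beta> x r"] allI impI)
    fix v w
    assume "(\<i> *s G x) \<bullet> iter_deriv [v] G x = 0" "(\<i> *s G x) \<bullet> iter_deriv [w] G x = 0"
    then have "\<beta> x v = 0" "\<beta> x w = 0" by (simp_all only: \<beta>_def)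
    \<comment> \<open>Taking the difference of both orders removes the second derivatives by
      symmetry and leaves twice the pulled-back symplectic forms.\<close>
    then have "(\<alpha>' w v - \<alpha>' v w) * \<beta> x r = \<alpha> x r * (\<beta>' w v - \<beta>' v w)"
      using key[of v w] key[of w v] by (simp add: left_diff_distrib right_diff_distrib)
    then have "((\<i> *s iter_deriv [v] F x) \<bullet> iter_deriv [w] F x) * \<beta> x r =
        \<alpha> x r * ((\<i> *s iter_deriv [v] G x) \<bullet> iter_deriv [w] G x)"
      unfolding skew_\<alpha> skew_\<beta> by simp
    then show "(\<i> *s iter_deriv [v] F x) \<bullet> iter_deriv [w] F x =
      \<alpha> x r / \<beta> x r * ((\<i> *s iter_deriv [v] G x) \<bullet> iter_deriv [w] G x)"
      using \<open>\<beta> x r \<noteq> 0\<close> by (simp add: field_simps)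
  qed
qed

text \<open>The differential of \<open>f\<close> at \<open>base_point\<close>, precomposed with the
  projection \<open>from_tangent\<close> so that it is defined on the whole space. Only its values
  on the contact hyperplane matter.\<close>

definition sphere_diff :: "(('n::finite) cvec \<Rightarrow> 'n cvec) \<Rightarrow> 'n cvec \<Rightarrow> 'n cvec" where
  "sphere_diff f z = iter_deriv [from_tangent z] (f \<circ> graph_chart) 0"

lemma iter_deriv_graph_chart_0: "iter_deriv [v] graph_chart 0 = to_tangent v"
  by (simp add: frechet_derivative_at[OF has_derivative_graph_chart_0, symmetric])

lemma smooth_on_comp_graph_chart:
  fixes f :: "('n::finite) cvec \<Rightarrow> 'n cvec"
  assumes "smooth_map_on unit_sphere f"
  shows "smooth_on (ball 0 1) (f \<circ> graph_chart)"
  by (rule smooth_map_on_compose_smooth_on[OF assms smooth_on_graph_chart])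
    (use graph_chart_in_sphere in auto)

lemma linear_sphere_diff:
  assumes "smooth_map_on unit_sphere f"
  shows "linear (sphere_diff f)"
  unfolding sphere_diff_def[abs_def]
  using linear_compose[OF bounded_linear.linear[OF bounded_linear_from_tangent]
      linear_iter_deriv_single[OF smooth_on_comp_graph_chart[OF assms], of 0]]
  by (simp add: o_def)

lemma contactomorphismsD:
  fixes f :: "('n::finite) cvec \<Rightarrow> 'n cvec"
  assumes "f \<in> contactomorphisms"
  shows "smooth_map_on unit_sphere f" "z \<in> unit_sphere \<Longrightarrow> f z \<in> unit_sphere"
  using assms unfolding contactomorphisms_def diffeomorphism_on_def by (auto dest: bij_betwE)

text \<open>A derivative within the sphere is determined only on tangent vectors. The derivative of
  the chart lands there, so by the chain rule any admissible \<open>D\<close> computes the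
  derivative of \<open>f\<close> in the chart.\<close>

lemma contactomorphism_chart_derivative:
  fixes f :: "('n::finite) cvec \<Rightarrow> 'n cvec"
  assumes f: "f \<in> contactomorphisms" and x: "x \<in> ball 0 1"
  obtains D where "D ` contact_structure (graph_chart x) = contact_structure (f (graph_chart x))"
    "\<And>v. iter_deriv [v] (f \<circ> graph_chart) x = D (iter_deriv [v] graph_chart x)"
proof -
  have "graph_chart x \<in> unit_sphere" by (rule graph_chart_in_sphere[OF x])
  then obtain D where D: "(f has_derivative D) (at (graph_chart x) within unit_sphere)"
    "D ` contact_structure (graph_chart x) = contact_structure (f (graph_chart x))"
    using f unfolding contactomorphisms_def by blast
  have g: "(graph_chart has_derivative (\<lambda>v. iter_deriv [v] graph_chart x)) (at x)"
    by (rule smooth_on_has_derivative[OF smooth_on_graph_chart x])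
  have "(graph_chart has_derivative (\<lambda>v. iter_deriv [v] graph_chart x)) (at x within ball 0 1)"
    using g by (rule has_derivative_at_withinI)
  moreover have "(f has_derivative D) (at (graph_chart x) within graph_chart ` ball 0 1)"
    using D(1) by (rule has_derivative_subset) (use graph_chart_in_sphere in auto)
  ultimately have "(f \<circ> graph_chart has_derivative D \<circ> (\<lambda>v. iter_deriv [v] graph_chart x)) (at x within ball 0 1)"
    by (rule diff_chain_within)
  then have "(f \<circ> graph_chart has_derivative D \<circ> (\<lambda>v. iter_deriv [v] graph_chart x)) (at x)"
    using at_within_open[OF x open_ball] by simp
  moreover have "(f \<circ> graph_chart has_derivative (\<lambda>v. iter_deriv [v] (f \<circ> graph_chart) x)) (at x)"
    by (rule smooth_on_has_derivative[OF smooth_on_comp_graph_chart[OF contactomorphismsD(1)[OF f]] x])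
  ultimately have "(\<lambda>v. iter_deriv [v] (f \<circ> graph_chart) x) = D \<circ> (\<lambda>v. iter_deriv [v] graph_chart x)"
    using has_derivative_unique by blast
  then show ?thesis using that[OF D(2)] by (simp add: fun_eq_iff)
qed

lemma contact_structure_base_point: "contact_structure base_point = {z. z $ None = 0}"
  by (simp add: contact_structure_eq[OF base_point_in_sphere] hip_base_point)

lemma sphere_diff_base_contact:
  fixes f :: "('n::finite) cvec \<Rightarrow> 'n cvec"
  assumes f: "f \<in> contactomorphisms"
  shows "sphere_diff f ` contact_structure base_point = contact_structure (f base_point)"
proof -
  obtain D where D: "D ` contact_structure (graph_chart 0) = contact_structure (f (graph_chart 0))"
    "\<And>v. iter_deriv [v] (f \<circ> graph_chart) 0 = D (iter_deriv [v] graph_chart 0)"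
    using contactomorphism_chart_derivative[OF f, of 0] by auto
  \<comment> \<open>Contact vectors have no component along \<open>base_point\<close>, so the
    projection in \<open>sphere_diff\<close> loses nothing on them.\<close>
  have "sphere_diff f z = D z" if "z \<in> contact_structure base_point" for z
    using that by (simp add: sphere_diff_def D(2) iter_deriv_graph_chart_0 to_from_tangent
        contact_structure_base_point del: iter_deriv.simps)
  then show ?thesis using D(1) by (simp add: graph_chart_0)
qed

lemma sphere_diff_conformal:
  fixes f :: "('n::finite) cvec \<Rightarrow> 'n cvec"
  assumes f: "f \<in> contactomorphisms"
  obtains \<mu> where "\<mu> \<noteq> 0" "\<And>v w. v \<in> contact_structure base_point \<Longrightarrow> w \<in> contact_structure base_point \<Longrightarrow>
    (\<i> *s sphere_diff f v) \<bullet> sphere_diff f w = \<mu> * ((\<i> *s v) \<bullet> w)"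
proof -
  let ?F = "f \<circ> graph_chart"
  have "\<exists>\<mu>. \<forall>v w. (\<i> *s graph_chart 0) \<bullet> iter_deriv [v] graph_chart 0 = 0 \<longrightarrow>
    (\<i> *s graph_chart 0) \<bullet> iter_deriv [w] graph_chart 0 = 0 \<longrightarrow>
    (\<i> *s iter_deriv [v] ?F 0) \<bullet> iter_deriv [w] ?F 0 =
      \<mu> * ((\<i> *s iter_deriv [v] graph_chart 0) \<bullet> iter_deriv [w] graph_chart (0 :: 'n chart_space))"
  proof (rule conformal_of_kernel_inclusion)
    show "smooth_on (ball 0 1) ?F"
      by (rule smooth_on_comp_graph_chart[OF contactomorphismsD(1)[OF f]])
    show "smooth_on (ball 0 1) (graph_chart :: 'n chart_space \<Rightarrow> _)" by (rule smooth_on_graph_chart)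
    fix y :: "'n chart_space" and v
    assume y: "y \<in> ball 0 1" and v: "(\<i> *s graph_chart y) \<bullet> iter_deriv [v] graph_chart y = 0"
    have gy: "graph_chart y \<in> unit_sphere" by (rule graph_chart_in_sphere[OF y])
    obtain D where D: "D ` contact_structure (graph_chart y) = contact_structure (f (graph_chart y))"
      "\<And>v. iter_deriv [v] ?F y = D (iter_deriv [v] graph_chart y)"
      using contactomorphism_chart_derivative[OF f y] by blast
    have "graph_chart y \<bullet> iter_deriv [v] graph_chart y = 0"
      by (rule inner_eq_0_of_sphere_valued[OF smooth_on_has_derivative[OF smooth_on_graph_chart y] open_ball y])
        (use graph_chart_in_sphere in blast)
    with v have "iter_deriv [v] graph_chart y \<in> contact_structure (graph_chart y)"
      by (simp add: contact_structure_eq[OF gy] hip_eq_0_iff del: iter_deriv.simps)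
    then have "iter_deriv [v] ?F y \<in> contact_structure (f (graph_chart y))"
      unfolding D(2) D(1)[symmetric] by (rule imageI)
    then show "(\<i> *s ?F y) \<bullet> iter_deriv [v] ?F y = 0"
      by (simp add: contact_structure_eq[OF contactomorphismsD(2)[OF f gy]] hip_eq_0_iff del: iter_deriv.simps)
  next
    \<comment> \<open>The transverse direction is the Reeb direction
      \<open>\<i> *s base_point\<close>, on which the contact form takes the value 1.\<close>
    have "to_tangent (from_tangent (\<i> *s base_point :: 'n cvec)) = \<i> *s base_point"
      by (simp add: to_from_tangent base_point_def)
    then show "(\<i> *s graph_chart 0) \<bullet> iter_deriv [from_tangent (\<i> *s base_point :: 'n cvec)] graph_chart 0 \<noteq> 0"
      by (simp add: iter_deriv_graph_chart_0 graph_chart_0 inner_imult_self base_point_inner_self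
          del: iter_deriv.simps)
  qed simp
  then obtain \<mu> where \<mu>: "\<And>v w. (\<i> *s base_point) \<bullet> to_tangent v = 0 \<Longrightarrow>
    (\<i> *s base_point) \<bullet> to_tangent (w :: 'n chart_space) = 0 \<Longrightarrow>
    (\<i> *s iter_deriv [v] ?F 0) \<bullet> iter_deriv [w] ?F 0 = \<mu> * ((\<i> *s to_tangent v) \<bullet> to_tangent w)"
    unfolding iter_deriv_graph_chart_0 graph_chart_0 by blast
  have conf: "(\<i> *s sphere_diff f v) \<bullet> sphere_diff f w = \<mu> * ((\<i> *s v) \<bullet> w)"
    if vw: "v \<in> contact_structure base_point" "w \<in> contact_structure base_point" for v w :: "'n cvec"
  proof -
    have tt: "to_tangent (from_tangent v) = v" "to_tangent (from_tangent w) = w"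
      using vw by (simp_all add: to_from_tangent contact_structure_base_point)
    have "(\<i> *s base_point) \<bullet> v = 0" "(\<i> *s base_point) \<bullet> w = 0"
      using vw by (simp_all add: contact_structure_eq[OF base_point_in_sphere] hip_eq_0_iff)
    then show ?thesis
      using \<mu>[of "from_tangent v" "from_tangent w"] unfolding tt sphere_diff_def by blast
  qed
  have fb: "f base_point \<in> unit_sphere" by (rule contactomorphismsD(2)[OF f base_point_in_sphere])
  \<comment> \<open>The image hyperplane contains both \<open>p\<close> and
    \<open>\<i> *s p\<close>, and the symplectic form on this pair is the squared norm of
    \<open>p\<close>. A zero factor would make it vanish.\<close>
  obtain p where p: "p \<in> contact_structure (f base_point)" "p \<noteq> 0"
    using contact_structure_nonzero[OF fb] .
  have ip: "\<i> *s p \<in> contact_structure (f base_point)"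
    using p(1) by (simp add: contact_structure_eq[OF fb] hip_scale_right)
  have "p \<in> sphere_diff f ` contact_structure base_point" "\<i> *s p \<in> sphere_diff f ` contact_structure base_point"
    using p(1) ip by (simp_all only: sphere_diff_base_contact[OF f])
  then obtain v w where vw: "v \<in> contact_structure base_point" "p = sphere_diff f v"
     "w \<in> contact_structure base_point" "\<i> *s p = sphere_diff f w" by blast
  have "p \<bullet> p = \<mu> * ((\<i> *s v) \<bullet> w)"
    using conf[OF vw(1,3)] unfolding vw(2,4)[symmetric] inner_imult_self .
  then have "\<mu> \<noteq> 0" using p(2) by auto
  then show ?thesis using that conf by blast
qed

section \<open>Gram--Schmidt retraction onto the unitary group\<close>

text \<open>Interpolates between the invertible matrices (\<open>S\<close> empty) and the unitary
  ones (\<open>S\<close> everything), so that Gram--Schmidt can treat one column at a time in any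
  order.\<close>

definition partial_frames :: "'k set \<Rightarrow> (complex ^ 'k ^ 'k::finite) set" where
  "partial_frames S = {A. (\<forall>c. A *v c = 0 \<longrightarrow> c = 0) \<and>
     (\<forall>i\<in>S. \<forall>j\<in>S. hip (column i A) (column j A) = (if i = j then 1 else 0))}"

definition gs_residue :: "'k set \<Rightarrow> 'k \<Rightarrow> complex ^ 'k ^ 'k::finite \<Rightarrow> complex ^ 'k" where
  "gs_residue S k A = column k A - (\<Sum>i\<in>S. hip (column i A) (column k A) *s column i A)"

definition gs_step :: "'k set \<Rightarrow> 'k \<Rightarrow> complex ^ 'k ^ 'k::finite \<Rightarrow> complex ^ 'k ^ 'k" where
  "gs_step S k A = (\<chi> r j. if j = k then gs_residue S k A $ r / of_real (norm (gs_residue S k A)) else A $ r $ j)"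

lemma continuous_on_column: "continuous_on X (\<lambda>A. column i A :: complex ^ 'k::finite)"
  unfolding column_def by (intro continuous_intros)

lemma continuous_on_hip:
  assumes "continuous_on X f" "continuous_on X g"
  shows "continuous_on X (\<lambda>x. hip (f x) (g x))"
  unfolding hip_def by (intro continuous_intros assms)

lemma continuous_on_scale:
  fixes g :: "'a::topological_space \<Rightarrow> complex ^ 'k::finite"
  assumes "continuous_on X f" "continuous_on X g"
  shows "continuous_on X (\<lambda>x. f x *s g x)"
  unfolding vector_scalar_mult_def by (intro continuous_intros assms)

lemma continuous_on_gs_residue: "continuous_on X (gs_residue S k)"
  unfolding gs_residue_def[abs_def]
  by (intro continuous_on_diff continuous_on_sum continuous_on_scale continuous_on_hip continuous_on_column)

lemma column_gs_step:
  "column j (gs_step S k A) = (if j = k then (1 / of_real (norm (gs_residue S k A))) *s gs_residue S k A else column j A)"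
  by (simp add: vec_eq_iff column_def gs_step_def)

text \<open>A vanishing residue would be a linear relation between the columns in which column
  \<open>k\<close> has coefficient 1.\<close>

lemma residue_nonzero:
  assumes A: "A \<in> partial_frames S" and k: "k \<notin> S"
  shows "gs_residue S k A \<noteq> 0"
proof
  assume 0: "gs_residue S k A = 0"
  define c where "c = (\<chi> j. if j = k then 1 else if j \<in> S then - hip (column j A) (column k A) else 0)"
  have "A *v c = (\<Sum>j\<in>UNIV. c $ j *s column j A)" by (rule matrix_mult_sum)
  also have "\<dots> = (\<Sum>j\<in>insert k S. c $ j *s column j A)"
    by (rule sum.mono_neutral_right) (auto simp: c_def)
  also have "\<dots> = column k A + (\<Sum>j\<in>S. c $ j *s column j A)"
    using k by (simp add: c_def)
  also have "(\<Sum>j\<in>S. c $ j *s column j A) = - (\<Sum>i\<in>S. hip (column i A) (column k A) *s column i A)"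
    unfolding sum_negf[symmetric] by (rule sum.cong) (use k in \<open>auto simp: c_def\<close>)
  also have "column k A + \<dots> = gs_residue S k A" by (simp add: gs_residue_def)
  finally have "c = 0" using A 0 unfolding partial_frames_def by simp
  then have "c $ k = 0" by simp
  then show False by (simp add: c_def)
qed

lemma gs_step_in_partial_frames:
  assumes A: "A \<in> partial_frames S" and k: "k \<notin> S"
  shows "gs_step S k A \<in> partial_frames (insert k S)"
proof -
  define w where "w = gs_residue S k A"
  define B where "B = gs_step S k A"
  have w0: "norm w \<noteq> 0" using residue_nonzero[OF assms] by (simp add: w_def)
  have col: "column j B = (if j = k then (1 / of_real (norm w)) *s w else column j A)" for j
    unfolding B_def w_def by (rule column_gs_step)
  have AS: "hip (column i A) (column j A) = (if i = j then 1 else 0)" if "i \<in> S" "j \<in> S" for i j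
    using A that unfolding partial_frames_def by blast
  have iw: "hip (column i A) w = 0" if i: "i \<in> S" for i
  proof -
    have "(\<Sum>j\<in>S. hip (column j A) (column k A) * hip (column i A) (column j A)) =
        (\<Sum>j\<in>S. if j = i then hip (column i A) (column k A) else 0)"
      by (rule sum.cong) (use AS i in auto)
    then show ?thesis
      using i by (simp add: w_def gs_residue_def hip_diff_right hip_sum_right hip_scale_right)
  qed
  then have wi: "hip w (column i A) = 0" if "i \<in> S" for i
    using that cnj_hip[of "column i A" w] by simp
  have "hip (column i B) (column j B) = (if i = j then 1 else 0)" if "i \<in> insert k S" "j \<in> insert k S" for i j
    using that k AS iw wi w0
    by (auto simp: col hip_scale_left hip_scale_right hip_self[of w] power2_eq_square)
  moreover have "c = 0" if "B *v c = 0" for c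
  proof -
    \<comment> \<open>These coefficients come from writing \<open>B *v c\<close> in terms of the
      columns of \<open>A\<close>: then \<open>A *v d = B *v c\<close>, and injectivity passes from
      \<open>A\<close> to \<open>B\<close>.\<close>
    define d where "d = (\<chi> j. if j = k then c $ k / of_real (norm w)
      else if j \<in> S then c $ j - c $ k / of_real (norm w) * hip (column j A) (column k A) else c $ j)"
    have UN: "(\<Sum>j\<in>UNIV. g j) = g k + (\<Sum>j\<in>UNIV - {k}. g j)" for g :: "'a \<Rightarrow> complex ^ 'a"
      by (simp add: sum.remove)
    have "(\<Sum>j\<in>UNIV - {k}. d $ j *s column j A) =
      (\<Sum>j\<in>UNIV - {k}. c $ j *s column j A) -
      (\<Sum>j\<in>UNIV - {k}. if j \<in> S then (c $ k / of_real (norm w) * hip (column j A) (column k A)) *s column j A else 0)"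
      unfolding sum_subtractf[symmetric]
      by (rule sum.cong) (auto simp: d_def vec_eq_iff algebra_simps)
    also have "(\<Sum>j\<in>UNIV - {k}. if j \<in> S then (c $ k / of_real (norm w) * hip (column j A) (column k A)) *s column j A else 0)
      = (\<Sum>j\<in>S. (c $ k / of_real (norm w) * hip (column j A) (column k A)) *s column j A)"
      by (rule sum.mono_neutral_cong_right) (use k in auto)
    also have "\<dots> = (c $ k / of_real (norm w)) *s (\<Sum>j\<in>S. hip (column j A) (column k A) *s column j A)"
      by (simp add: vec_eq_iff sum_distrib_left mult.assoc)
    finally have "A *v d = (\<Sum>j\<in>UNIV - {k}. c $ j *s column j A) + (c $ k / of_real (norm w)) *s w"
      unfolding matrix_mult_sum UN
      by (simp add: d_def w_def gs_residue_def vec_eq_iff algebra_simps)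
    also have "\<dots> = B *v c"
    proof -
      have "(\<Sum>j\<in>UNIV - {k}. c $ j *s column j B) = (\<Sum>j\<in>UNIV - {k}. c $ j *s column j A)"
        by (rule sum.cong) (auto simp: col)
      moreover have "c $ k *s column k B = (c $ k / of_real (norm w)) *s w"
        by (simp add: col vec_eq_iff)
      ultimately show ?thesis unfolding matrix_mult_sum UN by simp
    qed
    finally have "d = 0" using that A unfolding partial_frames_def by simp
    then have d: "d $ j = 0" for j by simp
    have "c $ k = 0" using d[of k] w0 by (simp add: d_def)
    then have "c $ j = 0" for j using d[of j] by (simp add: d_def split: if_splits)
    then show ?thesis by (simp add: vec_eq_iff)
  qed
  ultimately show ?thesis unfolding partial_frames_def B_def by blast
qed

text \<open>For an orthonormal column there is nothing to subtract and nothing to rescale. This is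
  what makes the composite of all steps a retraction.\<close>

lemma gs_step_fixes:
  assumes A: "A \<in> partial_frames (insert k S)" and k: "k \<notin> S"
  shows "gs_step S k A = A"
proof -
  have AS: "hip (column i A) (column j A) = (if i = j then 1 else 0)" if "i \<in> insert k S" "j \<in> insert k S" for i j
    using A that unfolding partial_frames_def by blast
  have "(\<Sum>i\<in>S. hip (column i A) (column k A) *s column i A) = (\<Sum>i\<in>S. 0)"
    by (rule sum.cong) (use AS k in auto)
  then have r: "gs_residue S k A = column k A" by (simp add: gs_residue_def)
  have "complex_of_real ((norm (column k A))\<^sup>2) = 1"
    unfolding hip_self[symmetric] using AS[of k k] by simp
  then have "(norm (column k A))\<^sup>2 = 1" by (simp only: of_real_eq_1_iff)
  then have "norm (column k A) = 1" by (rule power2_eq_imp_eq[of _ 1, simplified]) simp_all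
  then show ?thesis by (simp add: vec_eq_iff gs_step_def r column_def)
qed

lemma continuous_on_gs_step:
  assumes k: "k \<notin> S"
  shows "continuous_on (partial_frames S) (gs_step S k)"
  unfolding gs_step_def[abs_def]
proof (intro continuous_on_vec_lambda)
  fix r j
  have "continuous_on (partial_frames S) (\<lambda>A. gs_residue S k A $ r / complex_of_real (norm (gs_residue S k A)))"
    by (intro continuous_intros continuous_on_gs_residue) (use residue_nonzero[OF _ k] in auto)
  moreover have "continuous_on (partial_frames S) (\<lambda>A. A $ r $ j)" by (intro continuous_intros)
  ultimately show "continuous_on (partial_frames S)
    (\<lambda>A. if j = k then gs_residue S k A $ r / complex_of_real (norm (gs_residue S k A)) else A $ r $ j)"
    by (cases "j = k") auto
qed

lemma partial_frames_insert_subset: "partial_frames (insert k S) \<subseteq> partial_frames S"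
  by (auto simp: partial_frames_def)

text \<open>Orthonormality on a larger set of columns implies it on a smaller one, so the frames
  aimed at are fixed by every earlier step as well.\<close>

lemma partial_frames_retraction:
  "\<exists>r. continuous_on (partial_frames {}) r \<and> r ` partial_frames {} \<subseteq> partial_frames S \<and>
     (\<forall>A\<in>partial_frames S. r A = A)"
proof (induction S rule: finite_induct[OF finite])
  case 1
  show ?case by (intro exI[of _ id]) auto
next
  case (2 k S)
  then obtain r where r: "continuous_on (partial_frames {}) r" "r ` partial_frames {} \<subseteq> partial_frames S"
     "\<forall>A\<in>partial_frames S. r A = A" by blast
  have "continuous_on (partial_frames {}) (gs_step S k \<circ> r)"
    using r(1) continuous_on_subset[OF continuous_on_gs_step[OF 2(2)] r(2)] by (rule continuous_on_compose)
  moreover have "(gs_step S k \<circ> r) ` partial_frames {} \<subseteq> partial_frames (insert k S)"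
    using r(2) gs_step_in_partial_frames[OF _ 2(2)] by auto
  moreover have "(gs_step S k \<circ> r) A = A" if "A \<in> partial_frames (insert k S)" for A
  proof -
    have "r A = A" using that r(3) partial_frames_insert_subset by blast
    then show ?thesis by (simp add: gs_step_fixes[OF that 2(2)])
  qed
  ultimately show ?case by blast
qed

lemma conj_transpose_mult_nth: "(conj_transpose A ** A) $ i $ j = hip (column i A) (column j A)"
  by (simp add: conj_transpose_def matrix_matrix_mult_def hip_def column_def)

lemma unitary_group_eq_partial_frames: "unitary_group = partial_frames UNIV"
proof (intro equalityI subsetI)
  fix A :: "complex ^ 'a ^ 'a" assume "A \<in> unitary_group"
  then have A: "conj_transpose A ** A = mat 1" by (simp add: unitary_group_def)
  have "hip (column i A) (column j A) = (if i = j then 1 else 0)" for i j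
    using conj_transpose_mult_nth[of A i j] by (simp add: A mat_def)
  moreover have "c = 0" if "A *v c = 0" for c
  proof -
    have "c = conj_transpose A *v (A *v c)" by (simp add: matrix_vector_mul_assoc A)
    then show ?thesis by (simp add: that)
  qed
  ultimately show "A \<in> partial_frames UNIV" by (simp add: partial_frames_def)
next
  fix A :: "complex ^ 'a ^ 'a" assume "A \<in> partial_frames UNIV"
  then have "conj_transpose A ** A = mat 1"
    by (simp add: vec_eq_iff conj_transpose_mult_nth mat_def partial_frames_def)
  then show "A \<in> unitary_group"
    unfolding unitary_group_def using matrix_left_right_inverse by blast
qed

section \<open>The unitary frame of a contactomorphism\<close>

text \<open>The average of the real linear map \<open>L = sphere_diff f\<close> and its conjugate by
  multiplication with \<open>\<i>\<close>. It vanishes at \<open>z\<close> iff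
  \<open>L (\<i> z) = - \<i> L z\<close>.\<close>

definition complex_part :: "(('n::finite) cvec \<Rightarrow> 'n cvec) \<Rightarrow> 'n cvec \<Rightarrow> 'n cvec" where
  "complex_part f z = (1/2) *s (sphere_diff f z - \<i> *s sphere_diff f (\<i> *s z))"

text \<open>The \<open>None\<close> column is the image of the base point itself; the others are the
  complex linear part of the differential on the standard basis of the contact hyperplane.\<close>

definition frame_matrix :: "(('n::finite) cvec \<Rightarrow> 'n cvec) \<Rightarrow> complex ^ ('n option) ^ ('n option)" where
  "frame_matrix f = (\<chi> r j. (case j of None \<Rightarrow> f base_point | Some k \<Rightarrow> complex_part f (axis (Some k) 1)) $ r)"

text \<open>For a contactomorphism with conformal factor \<mu> the expression equals \<mu> times the
  squared norm of \<open>z\<close>, so the condition means \<mu> > 0. Written without \<mu>, it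
  depends visibly continuously on \<open>f\<close>.\<close>

definition taming :: "(('n::finite) cvec \<Rightarrow> 'n cvec) \<Rightarrow> bool" where
  "taming f \<longleftrightarrow> (\<forall>z\<in>contact_structure base_point. z \<noteq> 0 \<longrightarrow>
     (\<i> *s sphere_diff f z) \<bullet> sphere_diff f (\<i> *s z) > 0)"

lemma complex_part_add:
  assumes "smooth_map_on unit_sphere f"
  shows "complex_part f (x + y) = complex_part f x + complex_part f y"
  using linear_add[OF linear_sphere_diff[OF assms]]
  by (simp add: complex_part_def vector_add_ldistrib vec_eq_iff algebra_simps)

lemma complex_part_scale:
  fixes f :: "('n::finite) cvec \<Rightarrow> 'n cvec"
  assumes "smooth_map_on unit_sphere f"
  shows "complex_part f (c *s z) = c *s complex_part f z"
proof -
  \<comment> \<open>\<open>sphere_diff f\<close> is only real linear, so a complex multiple is split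
    into real multiples of \<open>z\<close> and \<open>\<i> *s z\<close>.\<close>
  have L: "sphere_diff f (c *s z) = of_real (Re c) *s sphere_diff f z + of_real (Im c) *s sphere_diff f (\<i> *s z)"
    for c :: complex
  proof -
    have "c *s z = Re c *\<^sub>R z + Im c *\<^sub>R (\<i> *s z)"
      by (simp add: vec_eq_iff complex_eq_iff)
    also have "sphere_diff f \<dots> = Re c *\<^sub>R sphere_diff f z + Im c *\<^sub>R sphere_diff f (\<i> *s z)"
      using linear_add[OF linear_sphere_diff[OF assms]] linear_cmul[OF linear_sphere_diff[OF assms]] by simp
    finally show ?thesis by (simp add: vec_eq_iff complex_eq_iff)
  qed
  have "\<i> *s (c *s z) = (\<i> * c) *s z" by (simp add: vec_eq_iff)
  then show ?thesis
    unfolding complex_part_def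
    by (simp add: L[of c] L[of "\<i> * c"]) (simp add: vec_eq_iff complex_eq_iff field_simps)
qed

text \<open>Pairing a relation between the columns with \<open>f base_point\<close> removes the
  first coefficient, as the other columns lie in the contact hyperplane there. What remains says
  that the complex part kills some \<open>z\<close>; then the taming expression at \<open>z\<close>
  is minus a squared norm, which forces \<open>z = 0\<close>.\<close>

lemma frame_matrix_in_frames:
  fixes f :: "('n::finite) cvec \<Rightarrow> 'n cvec"
  assumes f: "f \<in> contactomorphisms" and tame: "taming f"
  shows "frame_matrix f \<in> partial_frames {}"
proof -
  note sm = contactomorphismsD(1)[OF f]
  have P0: "complex_part f 0 = 0"
    using complex_part_scale[OF sm, of 0 0] by simp
  have Psum: "complex_part f (\<Sum>k\<in>I. g k) = (\<Sum>k\<in>I. complex_part f (g k))" for g :: "'n \<Rightarrow> 'n cvec" and I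
    by (induction I rule: infinite_finite_induct) (simp_all add: P0 complex_part_add[OF sm])
  have fb: "f base_point \<in> unit_sphere" by (rule contactomorphismsD(2)[OF f base_point_in_sphere])
  have "c = 0" if c: "frame_matrix f *v c = 0" for c
  proof -
    define z :: "'n cvec" where "z = (\<Sum>k\<in>UNIV. c $ Some k *s axis (Some k) 1)"
    have zS: "z $ Some k = c $ Some k" for k
    proof -
      have "z $ Some k = (\<Sum>l\<in>UNIV. if l = k then c $ Some k else 0)"
        unfolding z_def sum_component by (rule sum.cong) (auto simp: axis_def)
      then show ?thesis by simp
    qed
    have z: "z \<in> contact_structure base_point"
      by (simp add: contact_structure_base_point z_def axis_def)
    then have iz: "\<i> *s z \<in> contact_structure base_point"
      by (simp add: contact_structure_base_point)
    have col: "column None (frame_matrix f) = f base_point"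
      "column (Some k) (frame_matrix f) = complex_part f (axis (Some k) 1)" for k
      by (simp_all add: vec_eq_iff column_def frame_matrix_def)
    have "frame_matrix f *v c = c $ None *s f base_point + (\<Sum>k\<in>UNIV. c $ Some k *s complex_part f (axis (Some k) 1))"
      unfolding matrix_mult_sum UNIV_option_conv by (simp add: sum.reindex col)
    also have "(\<Sum>k\<in>UNIV. c $ Some k *s complex_part f (axis (Some k) 1)) = complex_part f z"
      unfolding z_def Psum by (simp add: complex_part_scale[OF sm])
    finally have eq: "c $ None *s f base_point + complex_part f z = 0" using c by simp
    have "sphere_diff f z \<in> contact_structure (f base_point)" "sphere_diff f (\<i> *s z) \<in> contact_structure (f base_point)"
      using z iz sphere_diff_base_contact[OF f] by blast+
    then have "hip (f base_point) (complex_part f z) = 0"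
      by (simp add: contact_structure_eq[OF fb] complex_part_def hip_scale_right hip_diff_right)
    then have "hip (f base_point) (c $ None *s f base_point + complex_part f z) = c $ None"
      using fb by (simp add: hip_add_right hip_scale_right hip_self)
    then have cN: "c $ None = 0" by (simp add: eq hip_def)
    with eq have "complex_part f z = 0" by simp
    then have "sphere_diff f z = \<i> *s sphere_diff f (\<i> *s z)"
      by (simp add: complex_part_def vec_eq_iff)
    then have "(\<i> *s sphere_diff f z) \<bullet> sphere_diff f (\<i> *s z) =
        - (sphere_diff f (\<i> *s z) \<bullet> sphere_diff f (\<i> *s z))"
      by (simp add: imult_imult)
    then have "\<not> (\<i> *s sphere_diff f z) \<bullet> sphere_diff f (\<i> *s z) > 0"
      using inner_ge_zero[of "sphere_diff f (\<i> *s z)"] by linarith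
    then have "z = 0" using tame z unfolding taming_def by blast
    then have "c $ j = 0" for j using zS cN by (cases j) auto
    then show ?thesis by (simp add: vec_eq_iff)
  qed
  then show ?thesis unfolding partial_frames_def by blast
qed

section \<open>Continuity of evaluations in the smooth topology\<close>

lemma continuous_map_euclidean_iff_tendsto:
  "continuous_map X euclidean f \<longleftrightarrow> (\<forall>x\<in>topspace X. (f \<longlongrightarrow> f x) (atin X x))"
  by (simp add: continuous_map_atin)

lemma topspace_C_infinity_topology:
  "topspace C_infinity_topology =
    {f :: ('n::finite) cvec \<Rightarrow> 'n cvec. f \<in> extensional unit_sphere \<and> smooth_map_on unit_sphere f}"
  (is "_ = ?R")
proof (intro equalityI subsetI)
  fix f :: "'n cvec \<Rightarrow> 'n cvec" assume "f \<in> topspace C_infinity_topology"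
  then show "f \<in> ?R"
    unfolding C_infinity_topology_def topology_generated_by_topspace by auto
next
  fix f :: "'n cvec \<Rightarrow> 'n cvec" assume f: "f \<in> ?R"
  \<comment> \<open>With an empty compact set the estimate is vacuous, so this single subbasic set
    is already the whole space.\<close>
  let ?N = "{g \<in> extensional unit_sphere. smooth_map_on unit_sphere g \<and>
    (\<forall>x\<in>{}. norm (iter_deriv [] (g \<circ> graph_chart) x - iter_deriv [] (f \<circ> graph_chart) x) < 1)}"
  have "f \<in> ?N" using f by simp
  moreover have "openin C_infinity_topology ?N"
    unfolding C_infinity_topology_def
  proof (rule topology_generated_by_Basis, rule CollectI)
    show "\<exists>(U :: 'n chart_space set) u K vs f' \<epsilon>.
      ?N = {g \<in> extensional unit_sphere. smooth_map_on unit_sphere g \<and>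
         (\<forall>x\<in>K. norm (iter_deriv vs (g \<circ> u) x - iter_deriv vs (f' \<circ> u) x) < \<epsilon>)} \<and>
      local_parametrization unit_sphere U u \<and> compact K \<and> K \<subseteq> U \<and>
         f' \<in> extensional unit_sphere \<and> smooth_map_on unit_sphere f' \<and> 0 < \<epsilon>"
      by (intro exI[of _ "ball 0 1"] exI[of _ graph_chart] exI[of _ "{}"] exI[of _ "[]"]
          exI[of _ f] exI[of _ "1::real"]) (use f local_parametrization_graph_chart in simp)
  qed
  ultimately show "f \<in> topspace C_infinity_topology" using openin_subset by blast
qed

lemma topspace_Cont_topology: "topspace Cont_topology = contactomorphisms"
  unfolding Cont_topology_def topspace_subtopology topspace_C_infinity_topology
  by (auto simp: contactomorphisms_def diffeomorphism_on_def)

text \<open>Subbasic sets with a one-point compact set are exactly the preimages of balls under this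
  evaluation.\<close>

lemma continuous_map_iter_deriv:
  fixes u :: "('n::finite) chart_space \<Rightarrow> 'n cvec"
  assumes u: "local_parametrization unit_sphere U u" and x: "x \<in> U"
  shows "continuous_map C_infinity_topology euclidean (\<lambda>f. iter_deriv vs (f \<circ> u) x)"
  unfolding continuous_map_euclidean_iff_tendsto
proof (intro ballI tendstoI)
  fix f :: "'n cvec \<Rightarrow> 'n cvec" and \<epsilon> :: real
  assume f: "f \<in> topspace C_infinity_topology" and \<epsilon>: "\<epsilon> > 0"
  let ?N = "{g \<in> extensional unit_sphere. smooth_map_on unit_sphere g \<and>
    (\<forall>x\<in>{x}. norm (iter_deriv vs (g \<circ> u) x - iter_deriv vs (f \<circ> u) x) < \<epsilon>)}"
  have "openin C_infinity_topology ?N"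
    unfolding C_infinity_topology_def
  proof (rule topology_generated_by_Basis, rule CollectI)
    show "\<exists>(U :: 'n chart_space set) u' K vs' f' \<epsilon>'.
      ?N = {g \<in> extensional unit_sphere. smooth_map_on unit_sphere g \<and>
         (\<forall>x\<in>K. norm (iter_deriv vs' (g \<circ> u') x - iter_deriv vs' (f' \<circ> u') x) < \<epsilon>')} \<and>
      local_parametrization unit_sphere U u' \<and> compact K \<and> K \<subseteq> U \<and>
         f' \<in> extensional unit_sphere \<and> smooth_map_on unit_sphere f' \<and> 0 < \<epsilon>'"
      by (intro exI[of _ U] exI[of _ u] exI[of _ "{x}"] exI[of _ vs]
          exI[of _ f] exI[of _ \<epsilon>]) (use f x u \<epsilon> in \<open>simp add: topspace_C_infinity_topology\<close>)
  qed
  moreover have "f \<in> ?N" using f \<epsilon> by (simp add: topspace_C_infinity_topology)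
  moreover have "dist (iter_deriv vs (g \<circ> u) x) (iter_deriv vs (f \<circ> u) x) < \<epsilon>" if "g \<in> ?N" for g
    using that by (simp add: dist_norm)
  ultimately show "\<forall>\<^sub>F g in atin C_infinity_topology f.
      dist (iter_deriv vs (g \<circ> u) x) (iter_deriv vs (f \<circ> u) x) < \<epsilon>"
    unfolding eventually_atin by blast
qed

lemma continuous_map_Cont_iter_deriv:
  "continuous_map Cont_topology euclidean (\<lambda>f. iter_deriv vs (f \<circ> graph_chart) 0)"
  unfolding Cont_topology_def
  by (intro continuous_map_from_subtopology continuous_map_iter_deriv[OF local_parametrization_graph_chart]) simp

lemma continuous_map_Cont_base_point: "continuous_map Cont_topology euclidean (\<lambda>f. f base_point)"
  using continuous_map_Cont_iter_deriv[of "[]"] by (simp add: graph_chart_0)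

lemma continuous_map_Cont_sphere_diff: "continuous_map Cont_topology euclidean (\<lambda>f. sphere_diff f z)"
  unfolding sphere_diff_def by (rule continuous_map_Cont_iter_deriv)

lemma tendsto_imult:
  fixes f :: "'a \<Rightarrow> complex ^ 'k::finite"
  shows "(f \<longlongrightarrow> a) F \<Longrightarrow> ((\<lambda>x. c *s f x) \<longlongrightarrow> c *s a) F"
  using bounded_linear.tendsto[OF bounded_linear_imult] by blast

lemma continuous_map_Cont_frame_matrix:
  "continuous_map Cont_topology euclidean (frame_matrix :: (('n::finite) cvec \<Rightarrow> 'n cvec) \<Rightarrow> _)"
  unfolding continuous_map_euclidean_iff_tendsto
proof
  fix f :: "'n cvec \<Rightarrow> 'n cvec" assume f: "f \<in> topspace Cont_topology"
  have b: "((\<lambda>g. g base_point) \<longlongrightarrow> f base_point) (atin Cont_topology f)"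
    using continuous_map_Cont_base_point f unfolding continuous_map_euclidean_iff_tendsto by blast
  have d: "((\<lambda>g. sphere_diff g z) \<longlongrightarrow> sphere_diff f z) (atin Cont_topology f)" for z
    using continuous_map_Cont_sphere_diff f unfolding continuous_map_euclidean_iff_tendsto by blast
  have c: "((\<lambda>g. complex_part g z) \<longlongrightarrow> complex_part f z) (atin Cont_topology f)" for z
    unfolding complex_part_def by (intro tendsto_imult tendsto_diff d)
  have "((\<lambda>g. case j of None \<Rightarrow> g base_point | Some k \<Rightarrow> complex_part g (axis (Some k) 1)) \<longlongrightarrow>
     (case j of None \<Rightarrow> f base_point | Some k \<Rightarrow> complex_part f (axis (Some k) 1))) (atin Cont_topology f)" for j
    by (cases j) (simp_all add: b c)
  then show "(frame_matrix \<longlongrightarrow> frame_matrix f) (atin Cont_topology f)"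
    unfolding frame_matrix_def[abs_def] by (intro tendsto_vec_lambda tendsto_vec_nth)
qed

lemma imult_contact_base:
  "z \<in> contact_structure base_point \<Longrightarrow> \<i> *s z \<in> contact_structure base_point"
  by (simp add: contact_structure_base_point)

text \<open>For fixed \<open>z\<close> the taming expression is continuous along the path and never
  0, so the intermediate value theorem preserves its sign.\<close>

lemma taming_path:
  fixes \<gamma> :: "real \<Rightarrow> ('n::finite) cvec \<Rightarrow> 'n cvec"
  assumes \<gamma>: "continuous_map (top_of_set {0..1}) Cont_topology \<gamma>" and tame: "taming (\<gamma> 0)"
    and s: "s \<in> {0..1}"
  shows "taming (\<gamma> s)"
  unfolding taming_def
proof (intro ballI impI)
  fix z :: "'n cvec" assume z: "z \<in> contact_structure base_point" "z \<noteq> 0"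
  define \<phi> where "\<phi> = (\<lambda>f :: 'n cvec \<Rightarrow> 'n cvec. (\<i> *s sphere_diff f z) \<bullet> sphere_diff f (\<i> *s z))"
  have "continuous_map Cont_topology euclidean \<phi>"
    unfolding continuous_map_euclidean_iff_tendsto \<phi>_def
  proof
    fix f :: "'n cvec \<Rightarrow> 'n cvec" assume f: "f \<in> topspace Cont_topology"
    have "((\<lambda>g. sphere_diff g z) \<longlongrightarrow> sphere_diff f z) (atin Cont_topology f)" for z
      using continuous_map_Cont_sphere_diff f unfolding continuous_map_euclidean_iff_tendsto by blast
    then show "((\<lambda>f. (\<i> *s sphere_diff f z) \<bullet> sphere_diff f (\<i> *s z)) \<longlongrightarrow>
      (\<i> *s sphere_diff f z) \<bullet> sphere_diff f (\<i> *s z)) (atin Cont_topology f)"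
      by (intro tendsto_inner tendsto_imult)
  qed
  then have "continuous_map (top_of_set {0..1}) euclidean (\<phi> \<circ> \<gamma>)"
    by (rule continuous_map_compose[OF \<gamma>])
  then have cont: "continuous_on {0..1} (\<phi> \<circ> \<gamma>)" by simp
  \<comment> \<open>Conformality applied to the pair \<open>z\<close> and \<open>\<i> *s z\<close>
    gives a nonzero factor times the squared norm of \<open>z\<close>.\<close>
  have nz: "\<phi> (\<gamma> t) \<noteq> 0" if "t \<in> {0..1}" for t
  proof -
    have "\<gamma> t \<in> contactomorphisms"
      using \<gamma> that continuous_map_image_subset_topspace topspace_Cont_topology by fastforce
    then obtain \<mu> where "\<mu> \<noteq> 0" "\<phi> (\<gamma> t) = \<mu> * ((\<i> *s z) \<bullet> (\<i> *s z))"
      using sphere_diff_conformal z(1) imult_contact_base[OF z(1)] unfolding \<phi>_def by metis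
    then show ?thesis using z(2) by (simp add: inner_imult_self)
  qed
  show "0 < (\<i> *s sphere_diff (\<gamma> s) z) \<bullet> sphere_diff (\<gamma> s) (\<i> *s z)"
  proof (rule ccontr)
    assume "\<not> ?thesis"
    then have "(\<phi> \<circ> \<gamma>) s \<le> 0" by (simp add: \<phi>_def)
    moreover have "0 \<le> (\<phi> \<circ> \<gamma>) 0" using tame z unfolding taming_def \<phi>_def by (simp add: less_imp_le)
    ultimately obtain t where "0 \<le> t" "t \<le> s" "(\<phi> \<circ> \<gamma>) t = 0"
      using IVT2'[of "\<phi> \<circ> \<gamma>" s 0 0] continuous_on_subset[OF cont] s by auto
    then show False using nz[of t] s by simp
  qed
qed

section \<open>The unitary action\<close>

lemma conj_transpose_conj_transpose: "conj_transpose (conj_transpose A) = A"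
  by (simp add: conj_transpose_def vec_eq_iff)

lemma conj_transpose_unitary: "A \<in> unitary_group \<Longrightarrow> conj_transpose A \<in> unitary_group"
  by (simp add: unitary_group_def conj_transpose_conj_transpose)

lemma unitary_inverse:
  assumes "A \<in> unitary_group"
  shows "conj_transpose A *v (A *v x) = x" "A *v (conj_transpose A *v x) = x"
  using assms by (simp_all add: unitary_group_def matrix_vector_mul_assoc)

lemma hip_adjoint: "hip (A *v x) y = hip x (conj_transpose A *v y)"
proof -
  have "hip (A *v x) y = (\<Sum>i\<in>UNIV. \<Sum>j\<in>UNIV. cnj (x $ j) * (cnj (A $ i $ j) * y $ i))"
    by (simp add: hip_def matrix_vector_mult_def sum_distrib_right mult.assoc mult.left_commute)
  also have "\<dots> = (\<Sum>j\<in>UNIV. \<Sum>i\<in>UNIV. cnj (x $ j) * (cnj (A $ i $ j) * y $ i))"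
    by (rule sum.swap)
  also have "\<dots> = hip x (conj_transpose A *v y)"
    by (simp add: hip_def matrix_vector_mult_def conj_transpose_def sum_distrib_left)
  finally show ?thesis .
qed

lemma hip_unitary: "A \<in> unitary_group \<Longrightarrow> hip (A *v x) (A *v y) = hip x y"
  by (simp add: hip_adjoint unitary_inverse)

lemma inner_unitary: "A \<in> unitary_group \<Longrightarrow> (A *v x) \<bullet> (A *v y) = x \<bullet> y"
  by (simp add: inner_eq_Re_hip hip_unitary)

lemma unitary_sphere: "A \<in> unitary_group \<Longrightarrow> A *v x \<in> sphere 0 1 \<longleftrightarrow> x \<in> sphere 0 1"
  by (simp add: norm_eq_sqrt_inner inner_unitary)

lemma bounded_linear_matrix: "bounded_linear (\<lambda>x. A *v x :: complex ^ 'k::finite)"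
  unfolding linear_conv_bounded_linear[symmetric]
  by (rule linearI) (simp_all add: vec_eq_iff matrix_vector_mult_def algebra_simps sum.distrib scaleR_sum_right)

lemma unitary_action_contactomorphism:
  fixes A :: "complex ^ ('n::finite option) ^ ('n option)"
  assumes A: "A \<in> unitary_group"
  shows "unitary_action A \<in> contactomorphisms"
proof -
  have val: "unitary_action A z = A *v z" if "z \<in> unit_sphere" for z
    using that by (simp add: unitary_action_def)
  have A': "conj_transpose A \<in> unitary_group" by (rule conj_transpose_unitary[OF A])
  have inj: "inj_on (unitary_action A) unit_sphere"
  proof (rule inj_on_inverseI)
    fix z :: "'n cvec" assume "z \<in> unit_sphere"
    then show "conj_transpose A *v unitary_action A z = z"
      by (subst val) (simp_all only: unitary_inverse[OF A])
  qed
  have bij: "bij_betw (unitary_action A) unit_sphere unit_sphere"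
  proof (rule bij_betw_imageI[OF inj], intro equalityI subsetI)
    fix z assume "z \<in> unitary_action A ` unit_sphere"
    then obtain y where y: "y \<in> unit_sphere" "z = unitary_action A y" by blast
    show "z \<in> unit_sphere" unfolding y(2) val[OF y(1)] unitary_sphere[OF A] by (rule y(1))
  next
    fix z :: "'n cvec" assume "z \<in> unit_sphere"
    then have z': "conj_transpose A *v z \<in> unit_sphere" unfolding unitary_sphere[OF A'] .
    have "z = unitary_action A (conj_transpose A *v z)"
      unfolding val[OF z'] unitary_inverse[OF A] by (rule refl)
    then show "z \<in> unitary_action A ` unit_sphere" using z' by (rule image_eqI)
  qed
  have "smooth_map_on unit_sphere (unitary_action A)"
    by (rule smooth_map_onI_UNIV[OF smooth_on_linear[OF bounded_linear_matrix[of A] open_UNIV]]) (rule val[symmetric])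
  moreover have "smooth_map_on unit_sphere (inv_into unit_sphere (unitary_action A))"
  proof (rule smooth_map_onI_UNIV[OF smooth_on_linear[OF bounded_linear_matrix[of "conj_transpose A"] open_UNIV]])
    fix z :: "'n cvec" assume "z \<in> unit_sphere"
    then have z': "conj_transpose A *v z \<in> unit_sphere" unfolding unitary_sphere[OF A'] .
    have "unitary_action A (conj_transpose A *v z) = z"
      unfolding val[OF z'] unitary_inverse[OF A] by (rule refl)
    then show "conj_transpose A *v z = inv_into unit_sphere (unitary_action A) z"
      by (rule inv_into_f_eq[OF inj z', symmetric])
  qed
  moreover have "\<exists>D. (unitary_action A has_derivative D) (at z within unit_sphere) \<and>
      D ` contact_structure z = contact_structure (unitary_action A z)" if z: "z \<in> unit_sphere" for z
  proof (intro exI conjI)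
    show "(unitary_action A has_derivative (\<lambda>v. A *v v)) (at z within unit_sphere)"
      by (rule has_derivative_transform[OF z val bounded_linear_imp_has_derivative[OF bounded_linear_matrix]])
    have Az: "A *v z \<in> unit_sphere" unfolding unitary_sphere[OF A] by (rule z)
    have "(\<lambda>v. A *v v) ` {v. hip z v = 0} = {v. hip (A *v z) v = 0}"
    proof (intro equalityI subsetI)
      fix v assume "v \<in> {v. hip (A *v z) v = 0}"
      then have "conj_transpose A *v v \<in> {v. hip z v = 0}" by (simp add: hip_adjoint)
      with unitary_inverse(2)[OF A, of v, symmetric] show "v \<in> (\<lambda>v. A *v v) ` {v. hip z v = 0}"
        by (rule image_eqI)
    qed (auto simp: hip_unitary[OF A])
    then show "(\<lambda>v. A *v v) ` contact_structure z = contact_structure (unitary_action A z)"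
      unfolding val[OF z] contact_structure_eq[OF z] contact_structure_eq[OF Az] .
  qed
  ultimately show ?thesis
    unfolding contactomorphisms_def diffeomorphism_on_def using bij
    by (simp add: unitary_action_def)
qed

section \<open>Continuity of the action in the smooth topology\<close>

lemma local_parametrization_image:
  "local_parametrization S U u \<Longrightarrow> u ` U \<subseteq> S"
  unfolding local_parametrization_def using openin_imp_subset by blast

lemma iter_deriv_unitary_action:
  fixes u :: "('n::finite) chart_space \<Rightarrow> 'n cvec"
  assumes u: "local_parametrization unit_sphere U u" and x: "x \<in> U"
  shows "iter_deriv vs (unitary_action A \<circ> u) x = A *v iter_deriv vs u x"
proof -
  have su: "smooth_on U u" using u by (simp add: local_parametrization_def)
  have "iter_deriv vs (unitary_action A \<circ> u) x = iter_deriv vs (\<lambda>y. A *v u y) x"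
    by (rule iter_deriv_cong[OF smooth_on_openD[OF su] _ x])
      (use local_parametrization_image[OF u] in \<open>auto simp: unitary_action_def\<close>)
  also have "\<dots> = A *v iter_deriv vs u x"
    by (rule iter_deriv_compose_linear[OF bounded_linear_matrix su x])
  finally show ?thesis .
qed

text \<open>It suffices to treat subbasic sets. In a chart the derivatives of the action are
  \<open>A\<close> applied to those of the chart, hence jointly continuous in \<open>A\<close> and
  the point; compactness of \<open>K\<close> makes the estimate an open condition on
  \<open>A\<close>.\<close>

lemma continuous_map_unitary_action:
  "continuous_map (top_of_set unitary_group) Cont_topology
    (unitary_action :: complex ^ ('n option) ^ ('n option) \<Rightarrow> ('n::finite) cvec \<Rightarrow> 'n cvec)"
  unfolding Cont_topology_def continuous_map_in_subtopology
proof (intro conjI)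
  show "unitary_action \<in> topspace (top_of_set unitary_group) \<rightarrow> contactomorphisms"
    using unitary_action_contactomorphism by auto
  show "continuous_map (top_of_set unitary_group) C_infinity_topology
    (unitary_action :: complex ^ ('n option) ^ ('n option) \<Rightarrow> 'n cvec \<Rightarrow> 'n cvec)"
    unfolding C_infinity_topology_def
  proof (rule continuous_on_generated_topo)
    have "unitary_action ` unitary_group \<subseteq> topspace (C_infinity_topology :: ('n cvec \<Rightarrow> 'n cvec) topology)"
      using unitary_action_contactomorphism
      by (auto simp: topspace_C_infinity_topology contactomorphisms_def diffeomorphism_on_def)
    then show "unitary_action ` topspace (top_of_set unitary_group) \<subseteq> \<Union>
      {{g \<in> extensional unit_sphere. smooth_map_on unit_sphere g \<and>
         (\<forall>x\<in>K. norm (iter_deriv vs (g \<circ> u) x - iter_deriv vs (f \<circ> u) x) < \<epsilon>)}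
      | (U :: 'n chart_space set) u K vs (f :: 'n cvec \<Rightarrow> 'n cvec) \<epsilon>.
         local_parametrization unit_sphere U u \<and> compact K \<and> K \<subseteq> U \<and>
         f \<in> extensional unit_sphere \<and> smooth_map_on unit_sphere f \<and> 0 < \<epsilon>}"
      unfolding C_infinity_topology_def topology_generated_by_topspace by simp
  next
    fix N assume "N \<in> {{g \<in> extensional unit_sphere. smooth_map_on unit_sphere g \<and>
         (\<forall>x\<in>K. norm (iter_deriv vs (g \<circ> u) x - iter_deriv vs (f \<circ> u) x) < \<epsilon>)}
      | (U :: 'n chart_space set) u K vs (f :: 'n cvec \<Rightarrow> 'n cvec) \<epsilon>.
         local_parametrization unit_sphere U u \<and> compact K \<and> K \<subseteq> U \<and>
         f \<in> extensional unit_sphere \<and> smooth_map_on unit_sphere f \<and> 0 < \<epsilon>}"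
    then obtain U :: "'n chart_space set" and u K vs f and \<epsilon> :: real
      where N: "N = {g \<in> extensional unit_sphere. smooth_map_on unit_sphere g \<and>
         (\<forall>x\<in>K. norm (iter_deriv vs (g \<circ> u) x - iter_deriv vs (f \<circ> u) x) < \<epsilon>)}"
        and u: "local_parametrization unit_sphere U u" and K: "compact K" "K \<subseteq> U"
        and f: "smooth_map_on unit_sphere f"
      by blast
    define d where "d = (\<lambda>x. iter_deriv vs u x)"
    define h where "h = (\<lambda>x. iter_deriv vs (f \<circ> u) x)"
    have su: "smooth_on U u" using u by (simp add: local_parametrization_def)
    have d: "continuous_on K d"
      unfolding d_def
      using continuous_on_subset[OF smooth_on_imp_continuous_on[OF smooth_on_iter_deriv[OF su]] K(2)] by simp
    have h: "continuous_on K h"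
      unfolding h_def
      using continuous_on_subset[OF smooth_on_imp_continuous_on[OF smooth_on_iter_deriv[OF
          smooth_map_on_compose_smooth_on[OF f su local_parametrization_image[OF u]]]] K(2)] by simp
    \<comment> \<open>The pairs violating the estimate form a closed set, and projecting along the
      compact factor \<open>K\<close> keeps it closed.\<close>
    let ?Z = "{p \<in> unitary_group \<times> K. \<epsilon> \<le> norm (fst p *v d (snd p) - h (snd p))}"
    have "unitary_action -` N \<inter> unitary_group = unitary_group - fst ` ?Z"
    proof -
      have "unitary_action A \<in> N \<longleftrightarrow> (\<forall>x\<in>K. norm (A *v d x - h x) < \<epsilon>)" if A: "A \<in> unitary_group" for A
      proof -
        have "iter_deriv vs (unitary_action A \<circ> u) x = A *v d x" if "x \<in> K" for x
          unfolding d_def by (rule iter_deriv_unitary_action[OF u]) (use that K(2) in blast)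
        then show ?thesis
          unfolding N h_def
          using unitary_action_contactomorphism[OF A]
          by (simp add: contactomorphisms_def diffeomorphism_on_def)
      qed
      then show ?thesis by (force simp: not_less image_iff)
    qed
    moreover have "closedin (top_of_set unitary_group) (fst ` ?Z)"
    proof -
      have dp: "continuous_on (unitary_group \<times> K) (\<lambda>p. d (snd p))"
        by (rule continuous_on_compose2[OF d continuous_on_snd[OF continuous_on_id]]) auto
      have hp: "continuous_on (unitary_group \<times> K) (\<lambda>p. h (snd p))"
        by (rule continuous_on_compose2[OF h continuous_on_snd[OF continuous_on_id]]) auto
      have "continuous_on (unitary_group \<times> K) (\<lambda>p. norm (fst p *v d (snd p) - h (snd p)))"
        unfolding matrix_vector_mult_def by (intro continuous_intros dp hp)
      then have "closedin (top_of_set (unitary_group \<times> K))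
          ((unitary_group \<times> K) \<inter> (\<lambda>p. norm (fst p *v d (snd p) - h (snd p))) -` {\<epsilon>..})"
        by (rule continuous_closedin_preimage) simp
      also have "(unitary_group \<times> K) \<inter> (\<lambda>p. norm (fst p *v d (snd p) - h (snd p))) -` {\<epsilon>..} = ?Z"
        by auto
      finally have "closedin (prod_topology (top_of_set unitary_group) (top_of_set K)) ?Z"
        by (simp add: prod_topology_subtopology_eu)
      moreover have "closed_map (prod_topology (top_of_set unitary_group) (top_of_set K)) (top_of_set unitary_group) fst"
        by (rule closed_map_fst) (use K(1) in \<open>simp add: compact_space_subtopology\<close>)
      ultimately show ?thesis unfolding closed_map_def by blast
    qed
    ultimately show "openin (top_of_set unitary_group) (unitary_action -` N \<inter> topspace (top_of_set unitary_group))"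
      by (simp add: closedin_def)
  qed
qed

text \<open>Limited to contact vectors because \<open>sphere_diff\<close> discards the component
  along \<open>base_point\<close>.\<close>

lemma sphere_diff_unitary_action:
  assumes "z \<in> contact_structure base_point"
  shows "sphere_diff (unitary_action A) z = A *v z"
  unfolding sphere_diff_def
    iter_deriv_unitary_action[OF local_parametrization_graph_chart centre_in_ball[THEN iffD2, OF zero_less_one]]
  using assms by (simp add: iter_deriv_graph_chart_0 to_from_tangent contact_structure_base_point del: iter_deriv.simps)

lemma taming_unitary_action:
  assumes A: "A \<in> unitary_group"
  shows "taming (unitary_action A)"
  unfolding taming_def
proof (intro ballI impI)
  fix z :: "'a cvec" assume z: "z \<in> contact_structure base_point" "z \<noteq> 0"
  have "\<i> *s (A *v z) = A *v (\<i> *s z)"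
    by (simp add: vector_scalar_commute)
  then have eq: "(\<i> *s (A *v z)) \<bullet> (A *v (\<i> *s z)) = z \<bullet> z"
    by (simp only: inner_unitary[OF A] inner_imult_self)
  then show "0 < (\<i> *s sphere_diff (unitary_action A) z) \<bullet> sphere_diff (unitary_action A) (\<i> *s z)"
    unfolding sphere_diff_unitary_action[OF z(1)] eq
      sphere_diff_unitary_action[OF imult_contact_base[OF z(1)]] using z(2) by simp
qed

text \<open>The action is complex linear, so passing to the complex part changes nothing and the
  columns of \<open>A\<close> come back.\<close>

lemma frame_matrix_unitary_action: "frame_matrix (unitary_action A) = A"
proof -
  have b: "unitary_action A base_point = A *v base_point"
    by (simp add: unitary_action_def norm_base_point)
  have c: "complex_part (unitary_action A) (axis (Some k) 1) = A *v axis (Some k) 1" for k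
  proof -
    have z: "axis (Some k) 1 \<in> contact_structure base_point"
      by (simp add: contact_structure_base_point axis_def)
    have "A *v (\<i> *s axis (Some k) 1) = \<i> *s (A *v axis (Some k) 1)"
      by (simp add: vector_scalar_commute)
    then show ?thesis
      by (simp add: complex_part_def sphere_diff_unitary_action[OF z]
        sphere_diff_unitary_action[OF imult_contact_base[OF z]] imult_imult vec_eq_iff)
  qed
  have "(case j of None \<Rightarrow> unitary_action A base_point | Some k \<Rightarrow> complex_part (unitary_action A) (axis (Some k) 1))
      = A *v axis j 1" for j
    by (cases j) (simp_all only: option.case base_point_def b[unfolded base_point_def] c)
  moreover have "A *v axis j 1 = column j A" for j
    by (simp add: vec_eq_iff matrix_vector_mult_def axis_def column_def if_distrib cong: if_cong)
  ultimately show ?thesis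
    by (simp add: vec_eq_iff frame_matrix_def column_def)
qed

lemma unitary_action_one: "unitary_action (mat 1) = restrict id unit_sphere"
  by (simp add: unitary_action_def id_def)

lemma mat_1_unitary: "mat 1 \<in> unitary_group"
proof -
  have "conj_transpose (mat 1) = (mat 1 :: complex ^ 'a ^ 'a)"
    by (simp add: conj_transpose_def mat_def vec_eq_iff)
  then show ?thesis by (simp add: unitary_group_def)
qed

section \<open>Functoriality of homotopy groups\<close>

lemma cube_boundary_subset: "t \<in> cube_boundary j \<Longrightarrow> t \<in> topspace (cube j)"
  by (simp add: cube_boundary_def)

lemma topspace_cube: "topspace (cube j) = ({..<j} \<rightarrow>\<^sub>E {0..1})"
  by (simp add: cube_def)

text \<open>Cube points are extensional; \<open>0 < j\<close> makes 0 one of their indices, so the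
  update stays extensional.\<close>

lemma cube_upd:
  "0 < j \<Longrightarrow> t \<in> topspace (cube j) \<Longrightarrow> a \<in> {0..1} \<Longrightarrow> t(0 := a) \<in> topspace (cube j)"
  unfolding topspace_cube by (auto simp: PiE_iff extensional_def)

lemma cube_nth: "i < j \<Longrightarrow> t \<in> topspace (cube j) \<Longrightarrow> t i \<in> {0..1}"
  unfolding topspace_cube by (simp add: PiE_iff)

lemma continuous_map_cube_upd:
  assumes j: "0 < j" and t: "continuous_map X (cube j) \<tau>" and a: "continuous_map X (top_of_set {0..1}) a"
  shows "continuous_map X (cube j) (\<lambda>x. (\<tau> x)(0 := a x))"
  unfolding cube_def continuous_map_componentwise
proof (intro conjI ballI)
  have img: "\<tau> x \<in> topspace (cube j)" "a x \<in> {0..1}" if "x \<in> topspace X" for x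
    using continuous_map_image_subset_topspace[OF t] continuous_map_image_subset_topspace[OF a] that by auto
  show "(\<lambda>x. (\<tau> x)(0 := a x)) ` topspace X \<subseteq> extensional {..<j}"
    using cube_upd[OF j img] unfolding topspace_cube by (auto simp: PiE_iff)
  fix k assume "k \<in> {..<j}"
  then have "continuous_map X (top_of_set {0..1}) (\<lambda>x. \<tau> x k)"
    using t unfolding cube_def continuous_map_componentwise by blast
  then show "continuous_map X (top_of_set {0..1}) (\<lambda>x. ((\<tau> x)(0 := a x)) k)"
    using a by (cases "k = 0") simp_all
qed

section \<open>Homotopy classes of spheroids, their products and induced maps\<close>

lemma spheroid_homotopic_sym: "spheroid_homotopic j X x0 f g \<Longrightarrow> spheroid_homotopic j X x0 g f"
  unfolding spheroid_homotopic_def by (rule homotopic_with_symD)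

lemma spheroid_homotopic_trans:
  "spheroid_homotopic j X x0 f g \<Longrightarrow> spheroid_homotopic j X x0 g h \<Longrightarrow> spheroid_homotopic j X x0 f h"
  unfolding spheroid_homotopic_def by (rule homotopic_with_trans)

lemma spheroid_homotopic_refl_iff: "spheroid_homotopic j X x0 f f \<longleftrightarrow> f \<in> spheroids j X x0"
  unfolding spheroid_homotopic_def spheroids_def by simp

lemma spheroid_class_cong:
  assumes "spheroid_homotopic j X x0 f g"
  shows "spheroid_class j X x0 f = spheroid_class j X x0 g"
  unfolding spheroid_class_def
  by (intro Collect_cong iffI)
    (erule spheroid_homotopic_trans[OF spheroid_homotopic_sym[OF assms]], erule spheroid_homotopic_trans[OF assms])

lemma spheroid_class_self: "f \<in> spheroids j X x0 \<Longrightarrow> f \<in> spheroid_class j X x0 f"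
  by (simp add: spheroid_class_def spheroid_homotopic_refl_iff)

lemma spheroid_class_eqD:
  "g \<in> spheroids j X x0 \<Longrightarrow> spheroid_class j X x0 f = spheroid_class j X x0 g \<Longrightarrow> spheroid_homotopic j X x0 f g"
  using spheroid_class_self[of g j X x0] unfolding spheroid_class_def by blast

text \<open>The two homotopies are concatenated at each time and glued along the slice where
  coordinate 0 is \<open>1/2\<close>.\<close>

lemma spheroid_homotopic_concat:
  assumes j: "0 < j" and f: "spheroid_homotopic j X x0 f f'" and g: "spheroid_homotopic j X x0 g g'"
  shows "spheroid_homotopic j X x0 (spheroid_concat f g) (spheroid_concat f' g')"
proof -
  let ?I = "top_of_set {0..1::real}"
  obtain H where H: "continuous_map (prod_topology ?I (cube j)) X H" "\<forall>x. H (0, x) = f x" "\<forall>x. H (1, x) = f' x"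
    "\<forall>s\<in>{0..1}. \<forall>t\<in>cube_boundary j. H (s, t) = x0"
    using f unfolding spheroid_homotopic_def homotopic_with_def by auto
  obtain K where K: "continuous_map (prod_topology ?I (cube j)) X K" "\<forall>x. K (0, x) = g x" "\<forall>x. K (1, x) = g' x"
    "\<forall>s\<in>{0..1}. \<forall>t\<in>cube_boundary j. K (s, t) = x0"
    using g unfolding spheroid_homotopic_def homotopic_with_def by auto
  define L where "L = (\<lambda>p. if snd p 0 \<le> 1/2 then H (fst p, (snd p)(0 := 2 * snd p 0))
    else K (fst p, (snd p)(0 := 2 * snd p 0 - 1)))"
  let ?P = "prod_topology ?I (cube j)"
  have c0: "continuous_map ?P ?I (\<lambda>p. snd p 0)"
  proof -
    have "continuous_map (cube j) ?I (\<lambda>t. t 0)"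
      unfolding cube_def by (rule continuous_map_product_projection) (use j in simp)
    from continuous_map_compose[OF continuous_map_snd this] show ?thesis by (simp add: o_def)
  qed
  then have c0': "continuous_map ?P euclideanreal (\<lambda>p. snd p 0)"
    by (simp add: continuous_map_in_subtopology)
  \<comment> \<open>Both halves at once: \<open>l\<close> is the affine rescaling of coordinate 0,
    which need take values in the unit interval only on \<open>S\<close>.\<close>
  have half: "continuous_map (subtopology ?P S) X (\<lambda>p. M (fst p, (snd p)(0 := l (snd p 0))))"
    if M: "continuous_map ?P X M" and l: "continuous_on UNIV l" "\<And>p. p \<in> topspace ?P \<Longrightarrow> p \<in> S \<Longrightarrow> l (snd p 0) \<in> {0..1}"
    for M and l :: "real \<Rightarrow> real" and S
  proof -
    have "continuous_map euclideanreal euclideanreal l" using l(1) by simp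
    from continuous_map_compose[OF c0' this]
    have "continuous_map ?P euclideanreal (\<lambda>p. l (snd p 0))" by (simp add: o_def)
    then have "continuous_map (subtopology ?P S) ?I (\<lambda>p. l (snd p 0))"
      unfolding continuous_map_in_subtopology using l(2)
      by (auto intro: continuous_map_from_subtopology)
    then have "continuous_map (subtopology ?P S) (cube j) (\<lambda>p. (snd p)(0 := l (snd p 0)))"
      by (rule continuous_map_cube_upd[OF j continuous_map_from_subtopology[OF continuous_map_snd]])
    then have "continuous_map (subtopology ?P S) ?P (\<lambda>p. (fst p, (snd p)(0 := l (snd p 0))))"
      by (rule continuous_map_pairedI[OF continuous_map_from_subtopology[OF continuous_map_fst]])
    from continuous_map_compose[OF this M] show ?thesis by (simp add: o_def)
  qed
  have "continuous_map ?P X L"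
    unfolding L_def
  proof (rule continuous_map_cases_le)
    show "continuous_map ?P euclideanreal (\<lambda>p. snd p 0)" by (rule c0')
    show "continuous_map ?P euclideanreal (\<lambda>p. 1/2)" by simp
    have r: "snd p 0 \<in> {0..1}" if "p \<in> topspace ?P" for p
      using cube_nth[OF j, of "snd p"] that by (auto simp: mem_Times_iff)
    show "continuous_map (subtopology ?P {p \<in> topspace ?P. snd p 0 \<le> 1/2}) X (\<lambda>p. H (fst p, (snd p)(0 := 2 * snd p 0)))"
    proof (rule half[OF H(1), of "\<lambda>a. 2 * a"])
      show "continuous_on UNIV (\<lambda>a::real. 2 * a)" by (intro continuous_intros)
    qed (use r in force)
    show "continuous_map (subtopology ?P {p \<in> topspace ?P. 1/2 \<le> snd p 0}) X (\<lambda>p. K (fst p, (snd p)(0 := 2 * snd p 0 - 1)))"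
    proof (rule half[OF K(1), of "\<lambda>a. 2 * a - 1"])
      show "continuous_on UNIV (\<lambda>a::real. 2 * a - 1)" by (intro continuous_intros)
    qed (use r in force)
    fix p assume p: "p \<in> topspace ?P" "snd p 0 = 1/2"
    then have fp: "fst p \<in> {0..1}" and sp: "snd p \<in> topspace (cube j)" by auto
    \<comment> \<open>On the slice the first homotopy is evaluated on the face 1 and the second on
      the face 0, so both give \<open>x0\<close>.\<close>
    have "(snd p)(0 := 1) \<in> cube_boundary j" "(snd p)(0 := 0) \<in> cube_boundary j"
      using cube_upd[OF j sp] j by (auto simp: cube_boundary_def)
    then show "H (fst p, (snd p)(0 := 2 * snd p 0)) = K (fst p, (snd p)(0 := 2 * snd p 0 - 1))"
    proof -
      have "2 * snd p 0 = 1" "2 * snd p 0 - 1 = 0" using p(2) by simp_all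
      then show ?thesis
        using H(4) K(4) fp \<open>(snd p)(0 := 1) \<in> cube_boundary j\<close> \<open>(snd p)(0 := 0) \<in> cube_boundary j\<close>
        by (simp only:)
    qed
  qed
  moreover have "L (s, t) = x0" if s: "s \<in> {0..1}" and t: "t \<in> cube_boundary j" for s t
  proof -
    obtain i where i: "i < j" "t i = 0 \<or> t i = 1" and tc: "t \<in> topspace (cube j)"
      using t by (auto simp: cube_boundary_def)
    have t0: "t 0 \<in> {0..1}" using cube_nth[OF j tc] .
    \<comment> \<open>A face in another coordinate survives rescaling. A face in coordinate 0 is the
      face 0 for the first half or the face 1 for the second, and the rescaling fixes these end
      values.\<close>
    have bd: "t(0 := a) \<in> cube_boundary j" if "a \<in> {0..1}" "i \<noteq> 0 \<or> a = 0 \<or> a = 1" for a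
    proof -
      have "(t(0 := a)) i = 0 \<or> (t(0 := a)) i = 1" using that(2) i(2) by auto
      then show ?thesis using cube_upd[OF j tc that(1)] i(1) unfolding cube_boundary_def by blast
    qed
    show ?thesis
    proof (cases "t 0 \<le> 1/2")
      case True
      then have "t(0 := 2 * t 0) \<in> cube_boundary j"
        using t0 i(2) by (intro bd) (auto simp del: bot_nat_0.not_eq_extremum)
      then show ?thesis using True H(4) s by (simp add: L_def)
    next
      case False
      then have "i \<noteq> 0 \<or> 2 * t 0 - 1 = 0 \<or> 2 * t 0 - 1 = 1"
        using i(2) by (cases "i = 0") auto
      then have "t(0 := 2 * t 0 - 1) \<in> cube_boundary j"
        using t0 False by (intro bd) auto
      then show ?thesis using False K(4) s by (simp add: L_def)
    qed
  qed
  moreover have "L (0, t) = spheroid_concat f g t" "L (1, t) = spheroid_concat f' g' t" for t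
    using H(2,3) K(2,3) by (simp_all add: L_def spheroid_concat_def)
  ultimately show ?thesis
    unfolding spheroid_homotopic_def homotopic_with_def by (intro exI[of _ L]) auto
qed

lemma spheroid_concat_in_spheroids:
  "0 < j \<Longrightarrow> f \<in> spheroids j X x0 \<Longrightarrow> g \<in> spheroids j X x0 \<Longrightarrow> spheroid_concat f g \<in> spheroids j X x0"
  using spheroid_homotopic_concat[of j X x0 f f g g] by (simp add: spheroid_homotopic_refl_iff)

text \<open>All choices of representatives give the same class, so the union defining the product
  collapses to that class.\<close>

lemma homotopy_group_mult:
  assumes j: "0 < j" and f: "f \<in> spheroids j X x0" and g: "g \<in> spheroids j X x0"
  shows "spheroid_class j X x0 f \<otimes>\<^bsub>homotopy_group j X x0\<^esub> spheroid_class j X x0 g =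
    spheroid_class j X x0 (spheroid_concat f g)"
proof -
  have "spheroid_class j X x0 (spheroid_concat f' g') = spheroid_class j X x0 (spheroid_concat f g)"
    if "f' \<in> spheroid_class j X x0 f" "g' \<in> spheroid_class j X x0 g" for f' g'
    by (rule spheroid_class_cong[symmetric], rule spheroid_homotopic_concat[OF j])
      (use that in \<open>simp_all add: spheroid_class_def\<close>)
  then show ?thesis
    using spheroid_class_self[OF f] spheroid_class_self[OF g]
    unfolding homotopy_group_def monoid.simps by blast
qed

lemma spheroid_homotopic_compose:
  assumes \<phi>: "continuous_map X Y \<phi>" "\<phi> x0 = y0" and f: "spheroid_homotopic j X x0 f g"
  shows "spheroid_homotopic j Y y0 (\<phi> \<circ> f) (\<phi> \<circ> g)"
  using f unfolding spheroid_homotopic_def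
  by (rule homotopic_with_compose_continuous_map_left[OF _ \<phi>(1)]) (simp add: \<phi>(2))

lemma homotopy_group_map_class:
  assumes \<phi>: "continuous_map X Y \<phi>" "\<phi> x0 = y0" and f: "f \<in> spheroids j X x0"
  shows "homotopy_group_map j Y y0 \<phi> (spheroid_class j X x0 f) = spheroid_class j Y y0 (\<phi> \<circ> f)"
proof -
  have "spheroid_class j Y y0 (\<phi> \<circ> f') = spheroid_class j Y y0 (\<phi> \<circ> f)"
    if "f' \<in> spheroid_class j X x0 f" for f'
    by (rule spheroid_class_cong[symmetric], rule spheroid_homotopic_compose[OF \<phi>])
      (use that in \<open>simp add: spheroid_class_def\<close>)
  then show ?thesis
    using spheroid_class_self[OF f] unfolding homotopy_group_map_def by blast
qed

lemma spheroids_compose: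
  "continuous_map X Y \<phi> \<Longrightarrow> \<phi> x0 = y0 \<Longrightarrow> f \<in> spheroids j X x0 \<Longrightarrow> \<phi> \<circ> f \<in> spheroids j Y y0"
  using spheroid_homotopic_compose[of X Y \<phi> x0 y0 j f f] by (simp add: spheroid_homotopic_refl_iff)

lemma compose_spheroid_concat: "\<phi> \<circ> spheroid_concat f g = spheroid_concat (\<phi> \<circ> f) (\<phi> \<circ> g)"
  by (auto simp: spheroid_concat_def)

lemma carrier_homotopy_group: "carrier (homotopy_group j X x0) = spheroid_class j X x0 ` spheroids j X x0"
  by (simp add: homotopy_group_def)

lemma homotopy_group_map_hom:
  assumes j: "0 < j" and \<phi>: "continuous_map X Y \<phi>" "\<phi> x0 = y0"
  shows "homotopy_group_map j Y y0 \<phi> \<in> hom (homotopy_group j X x0) (homotopy_group j Y y0)"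
proof (rule homI)
  fix a assume "a \<in> carrier (homotopy_group j X x0)"
  then obtain f where f: "f \<in> spheroids j X x0" "a = spheroid_class j X x0 f"
    unfolding carrier_homotopy_group by blast
  show "homotopy_group_map j Y y0 \<phi> a \<in> carrier (homotopy_group j Y y0)"
    unfolding f(2) homotopy_group_map_class[OF \<phi> f(1)] carrier_homotopy_group
    by (rule imageI, rule spheroids_compose[OF \<phi> f(1)])
  fix b assume "b \<in> carrier (homotopy_group j X x0)"
  then obtain g where g: "g \<in> spheroids j X x0" "b = spheroid_class j X x0 g"
    unfolding carrier_homotopy_group by blast
  show "homotopy_group_map j Y y0 \<phi> (a \<otimes>\<^bsub>homotopy_group j X x0\<^esub> b) =
      homotopy_group_map j Y y0 \<phi> a \<otimes>\<^bsub>homotopy_group j Y y0\<^esub> homotopy_group_map j Y y0 \<phi> b"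
    unfolding f(2) g(2) homotopy_group_mult[OF j f(1) g(1)] homotopy_group_map_class[OF \<phi> f(1)]
      homotopy_group_map_class[OF \<phi> g(1)]
      homotopy_group_map_class[OF \<phi> spheroid_concat_in_spheroids[OF j f(1) g(1)]]
      homotopy_group_mult[OF j spheroids_compose[OF \<phi> f(1)] spheroids_compose[OF \<phi> g(1)]]
      compose_spheroid_concat by (rule refl)
qed

text \<open>Reduces injectivity on classes to a statement about individual spheroids: a homotopy
  between the images must yield one between the originals.\<close>

lemma homotopy_group_map_mon:
  assumes j: "0 < j" and \<phi>: "continuous_map X Y \<phi>" "\<phi> x0 = y0"
    and inj: "\<And>f g. f \<in> spheroids j X x0 \<Longrightarrow> g \<in> spheroids j X x0 \<Longrightarrow>
      spheroid_homotopic j Y y0 (\<phi> \<circ> f) (\<phi> \<circ> g) \<Longrightarrow> spheroid_homotopic j X x0 f g"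
  shows "homotopy_group_map j Y y0 \<phi> \<in> mon (homotopy_group j X x0) (homotopy_group j Y y0)"
  unfolding mon_def mem_Collect_eq
proof (intro conjI homotopy_group_map_hom[OF j \<phi>] inj_onI)
  fix a b assume ab: "a \<in> carrier (homotopy_group j X x0)" "b \<in> carrier (homotopy_group j X x0)"
    and eq: "homotopy_group_map j Y y0 \<phi> a = homotopy_group_map j Y y0 \<phi> b"
  obtain f where f: "f \<in> spheroids j X x0" "a = spheroid_class j X x0 f"
    using ab(1) unfolding carrier_homotopy_group by blast
  obtain g where g: "g \<in> spheroids j X x0" "b = spheroid_class j X x0 g"
    using ab(2) unfolding carrier_homotopy_group by blast
  have "spheroid_homotopic j Y y0 (\<phi> \<circ> f) (\<phi> \<circ> g)"
    by (rule spheroid_class_eqD[OF spheroids_compose[OF \<phi> g(1)]])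
      (use eq in \<open>simp only: f(2) g(2) homotopy_group_map_class[OF \<phi> f(1)] homotopy_group_map_class[OF \<phi> g(1)]\<close>)
  from inj[OF f(1) g(1) this] show "a = b"
    unfolding f(2) g(2) by (rule spheroid_class_cong)
qed

section \<open>The homotopy left inverse\<close>

lemma spheroid_homotopic_of_unitary_action:
  fixes f g :: "(nat \<Rightarrow> real) \<Rightarrow> complex ^ ('n::finite option) ^ ('n option)"
  assumes f: "f \<in> spheroids j (top_of_set unitary_group) (mat 1)"
    and g: "g \<in> spheroids j (top_of_set unitary_group) (mat 1)"
    and hom: "spheroid_homotopic j Cont_topology (restrict id unit_sphere) (unitary_action \<circ> f) (unitary_action \<circ> g)"
  shows "spheroid_homotopic j (top_of_set unitary_group) (mat 1) f g"
proof -
  obtain r :: "complex ^ ('n option) ^ ('n option) \<Rightarrow> complex ^ ('n option) ^ ('n option)"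
    where r: "continuous_on (partial_frames {}) r" "r ` partial_frames {} \<subseteq> unitary_group"
      "\<And>A. A \<in> unitary_group \<Longrightarrow> r A = A"
  proof -
    obtain r where "continuous_on (partial_frames {}) r" "r ` partial_frames {} \<subseteq> partial_frames UNIV"
      "\<forall>A\<in>partial_frames (UNIV :: 'n option set). r A = A"
      using partial_frames_retraction[of "UNIV :: 'n option set"] by blast
    then show ?thesis by (intro that[of r]) (simp_all add: unitary_group_eq_partial_frames)
  qed
  let ?P = "prod_topology (top_of_set {0..1::real}) (cube j)"
  obtain H where H: "continuous_map ?P Cont_topology H" "\<forall>t. H (0, t) = unitary_action (f t)"
    "\<forall>t. H (1, t) = unitary_action (g t)"
    "\<forall>s\<in>{0..1}. \<forall>t\<in>cube_boundary j. H (s, t) = restrict id unit_sphere"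
    using hom unfolding spheroid_homotopic_def homotopic_with_def by auto
  have fU: "f t \<in> unitary_group" "g t \<in> unitary_group" if "t \<in> topspace (cube j)" for t
    using f g that continuous_map_image_subset_topspace unfolding spheroids_def by fastforce+
  have frame: "frame_matrix (H p) \<in> partial_frames {}" if p: "p \<in> topspace ?P" for p
  proof -
    obtain s t where st: "p = (s, t)" "s \<in> {0..1}" "t \<in> topspace (cube j)" using p by auto
    \<comment> \<open>For fixed \<open>t\<close> the homotopy is a path starting at the action of
      \<open>f t\<close>, where taming holds; it then holds along the whole path.\<close>
    have "continuous_map (top_of_set {0..1}) ?P (\<lambda>s. (s, t))"
      by (intro continuous_map_pairedI) (use st(3) in auto)
    from continuous_map_compose[OF this H(1)]
    have "continuous_map (top_of_set {0..1}) Cont_topology (\<lambda>s. H (s, t))" by (simp add: o_def)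
    then have "taming (H (s, t))"
      by (rule taming_path) (use st(2) H(2) taming_unitary_action[OF fU(1)[OF st(3)]] in auto)
    moreover have "H (s, t) \<in> contactomorphisms"
      using continuous_map_image_subset_topspace[OF H(1)] p st(1) unfolding topspace_Cont_topology by blast
    ultimately show ?thesis unfolding st(1) by (intro frame_matrix_in_frames)
  qed
  have "continuous_map ?P (top_of_set (partial_frames {})) (\<lambda>p. frame_matrix (H p))"
    using continuous_map_compose[OF H(1) continuous_map_Cont_frame_matrix] frame
    unfolding continuous_map_in_subtopology by (auto simp: o_def)
  moreover have "continuous_map (top_of_set (partial_frames {})) (top_of_set unitary_group) r"
    using r(1,2) by auto
  ultimately have cont: "continuous_map ?P (top_of_set unitary_group) (r \<circ> (\<lambda>p. frame_matrix (H p)))"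
    by (rule continuous_map_compose)
  have id: "r (frame_matrix (unitary_action A)) = A" if "A \<in> unitary_group" for A
    by (simp add: frame_matrix_unitary_action r(3)[OF that])
  have "homotopic_with (\<lambda>h. \<forall>t\<in>cube_boundary j. h t = mat 1) (cube j) (top_of_set unitary_group) f g"
  \<comment> \<open>The values of \<open>f\<close> and \<open>g\<close> are known to be unitary only
    on the cube, so the new homotopy need have the right ends only there.\<close>
  proof (subst homotopic_with)
    show "(\<forall>t\<in>cube_boundary j. h t = mat 1) \<longleftrightarrow> (\<forall>t\<in>cube_boundary j. k t = mat 1)"
      if "\<And>t. t \<in> topspace (cube j) \<Longrightarrow> h t = k t" for h k :: "(nat \<Rightarrow> real) \<Rightarrow> complex ^ ('n option) ^ ('n option)"
      using that cube_boundary_subset by metis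
    show "\<exists>h. continuous_map ?P (top_of_set unitary_group) h \<and> (\<forall>t\<in>topspace (cube j). h (0, t) = f t) \<and>
        (\<forall>t\<in>topspace (cube j). h (1, t) = g t) \<and> (\<forall>s\<in>{0..1}. \<forall>t\<in>cube_boundary j. h (s, t) = mat 1)"
    proof (intro exI conjI ballI)
      show "continuous_map ?P (top_of_set unitary_group) (\<lambda>p. r (frame_matrix (H p)))"
        using cont by (simp add: o_def)
      fix t assume "t \<in> topspace (cube j)"
      then show "r (frame_matrix (H (0, t))) = f t" "r (frame_matrix (H (1, t))) = g t"
        using H(2,3) id fU by simp_all
    next
      fix s :: real and t assume "s \<in> {0..1}" "t \<in> cube_boundary j"
      then show "r (frame_matrix (H (s, t))) = mat 1"
        using H(4) id[OF mat_1_unitary] by (simp add: unitary_action_one)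
    qed
  qed
  then show ?thesis unfolding spheroid_homotopic_def .
qed

theorem theorem1:
  fixes j :: nat
  assumes "1 \<le> j" and "j \<le> 2 * CARD('n::finite) + 1"
  shows "homotopy_group_map j (Cont_topology :: ('n cvec \<Rightarrow> 'n cvec) topology)
           (restrict id unit_sphere) unitary_action
         \<in> mon (homotopy_group j (top_of_set unitary_group) (mat 1))
               (homotopy_group j Cont_topology (restrict id unit_sphere))"
proof (rule homotopy_group_map_mon[OF _ continuous_map_unitary_action unitary_action_one])
  show "0 < j" using assms(1) by simp
qed (rule spheroid_homotopic_of_unitary_action)

end
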